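(* Let $(M,g,\mathcal{E})$ be an embedded ambient structure. The tangent bundle $TM$ is the submanifold of $\mathcal{E}^2$ consisting of pairs $(x,v)$ with $x\in M$, $v\in\mathcal{E}$ such that $\Pi_{g,x}v=v$. The tangent bundle $TTM$ of $TM$ is the submanifold of $\mathcal{E}^4$ consisting of quadruples $(x,v,\Delta_m,\Delta_t)\in\mathcal{E}^4$ with $x\in M$ satisfying $$\Pi_{g,x}v=v,\qquad \Pi_{g,x}\Delta_m=\Delta_m,\qquad (D_{\Delta_m}\Pi_g)_xv+\Pi_{g,x}\Delta_t=\Delta_t .$$ In particular, $\Delta_m$ is a tangent vector at $x$. If $v=0$ or $\Delta_m=0$, then $\Delta_t$ is also a tangent vector at $x$. If $(x,v,\Delta_m,\Delta_t)\in TTM$ then $(x,\Delta_m,v,\Delta_t)\in TTM$.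
   Context: $\mathcal{E}$ is a finite-dimensional real inner product space. An embedded ambient structure $(M,g,\mathcal{E})$ consists of a Riemannian manifold $M$ differentiably embedded as a submanifold of $\mathcal{E}$ (so $T_xM\subset\mathcal{E}$) and a metric operator: a smooth map $g:M\to L(\mathcal{E},\mathcal{E})$ with each $g_x$ (self-adjoint) positive-definite and $\langle\xi,g_x\eta\rangle_{\mathcal{E}}$ equal to the Riemannian inner product of $\xi,\eta\in T_xM$. $\Pi_{g,x}$ is the projection of $\mathcal{E}$ onto $T_xM$ orthogonal for $\langle\cdot,g_x\cdot\rangle_{\mathcal{E}}$; $\Pi_g:M\to L(\mathcal{E},\mathcal{E})$ is smooth and $D_\xi\Pi_g$ is its directional derivative. $TM$ is embedded in $\mathcal{E}^2$ by $(x,v)$ with $v\in T_xM\subset\mathcal{E}$, and correspondingly $TTM\subset\mathcal{E}^4$. *)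

theory Defs
  imports "HOL-Analysis.Analysis"
begin

text \<open>
  In the second clause \<open>v\<close> ranges over all directions, so (the domain being finite-dimensional)
  this is continuity of all partial derivatives up to order \<open>k\<close>.
\<close>

primrec Ck_on :: "nat \<Rightarrow> ('a::euclidean_space \<Rightarrow> 'b::real_normed_vector) \<Rightarrow> 'a set \<Rightarrow> bool" where
  "Ck_on 0 f U \<longleftrightarrow> continuous_on U f"
| "Ck_on (Suc k) f U \<longleftrightarrow>
     (\<forall>x\<in>U. f differentiable (at x)) \<and>
     (\<forall>v. Ck_on k (\<lambda>x. frechet_derivative f (at x) v) U)"

text \<open>Only meant for open \<open>U\<close>; see \<open>smooth_map_on\<close> for submanifolds.\<close>

definition smooth_on :: "('a::euclidean_space \<Rightarrow> 'b::real_normed_vector) \<Rightarrow> 'a set \<Rightarrow> bool" where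
  "smooth_on f U \<longleftrightarrow> (\<forall>k. Ck_on k f U)"

definition diffeomorphism ::
    "('a::euclidean_space \<Rightarrow> 'b::euclidean_space) \<Rightarrow> ('b \<Rightarrow> 'a) \<Rightarrow> 'a set \<Rightarrow> 'b set \<Rightarrow> bool" where
  "diffeomorphism \<phi> \<psi> U V \<longleftrightarrow>
     open U \<and> open V \<and> smooth_on \<phi> U \<and> smooth_on \<psi> V \<and> \<phi> ` U = V \<and> \<psi> ` V = U \<and>
     (\<forall>x\<in>U. \<psi> (\<phi> x) = x) \<and> (\<forall>y\<in>V. \<phi> (\<psi> y) = y)"

text \<open>Slice charts, the model slice being a \<open>d\<close>-dimensional linear subspace \<open>L\<close>.\<close>

definition embedded_submanifold :: "nat \<Rightarrow> 'a::euclidean_space set \<Rightarrow> bool" where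
  "embedded_submanifold d M \<longleftrightarrow>
     (\<forall>x\<in>M. \<exists>(U::'a set) (V::'a set) \<phi> \<psi> L.
        x \<in> U \<and> diffeomorphism \<phi> \<psi> U V \<and> subspace L \<and> dim L = d \<and> \<phi> ` (U \<inter> M) = V \<inter> L)"

text \<open>Smoothness on a submanifold: local smooth extendability to the ambient space.\<close>

definition smooth_map_on :: "'a::euclidean_space set \<Rightarrow> ('a \<Rightarrow> 'b::real_normed_vector) \<Rightarrow> bool" where
  "smooth_map_on M f \<longleftrightarrow>
     (\<forall>x\<in>M. \<exists>U F. open U \<and> x \<in> U \<and> smooth_on F U \<and> (\<forall>y\<in>U \<inter> M. F y = f y))"

definition curve_with_velocity ::
    "'a::euclidean_space set \<Rightarrow> 'a \<Rightarrow> 'a \<Rightarrow> (real \<Rightarrow> 'a) \<Rightarrow> bool" where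
  "curve_with_velocity M x v \<gamma> \<longleftrightarrow>
     (\<exists>\<epsilon>>0. smooth_on \<gamma> {-\<epsilon><..<\<epsilon>} \<and> \<gamma> ` {-\<epsilon><..<\<epsilon>} \<subseteq> M) \<and>
     \<gamma> 0 = x \<and> (\<gamma> has_vector_derivative v) (at 0)"

definition tangent_space :: "'a::euclidean_space set \<Rightarrow> 'a \<Rightarrow> 'a set" where
  "tangent_space M x = {v. \<exists>\<gamma>. curve_with_velocity M x v \<gamma>}"

text \<open>
  The tangent bundle of \<open>M \<subseteq> \<E>\<close> is a subset of \<open>\<E>\<^sup>2\<close>; hence
  \<open>tangent_bundle (tangent_bundle M)\<close> is a subset of \<open>\<E>\<^sup>4\<close>, where a quadruple
  \<open>(x, v, \<Delta>\<^sub>m, \<Delta>\<^sub>t)\<close> is written \<open>((x, v), (\<Delta>\<^sub>m, \<Delta>\<^sub>t))\<close>.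
\<close>

definition tangent_bundle :: "'a::euclidean_space set \<Rightarrow> ('a \<times> 'a) set" where
  "tangent_bundle M = {(x, v). x \<in> M \<and> v \<in> tangent_space M x}"

text \<open>
  The directional derivative \<open>(D\<^sub>\<xi> F)\<^sub>x\<close> of a map given on \<open>M\<close> only, computed along curves in \<open>M\<close>.
  It is meaningful when \<open>\<xi>\<close> is tangent to \<open>M\<close> at \<open>x\<close> and \<open>F\<close> is smooth on \<open>M\<close>.
\<close>

definition dir_deriv ::
    "'a::euclidean_space set \<Rightarrow> ('a \<Rightarrow> 'b::real_normed_vector) \<Rightarrow> 'a \<Rightarrow> 'a \<Rightarrow> 'b" where
  "dir_deriv M F \<xi> x =
     (THE D. \<forall>\<gamma>. curve_with_velocity M x \<xi> \<gamma> \<longrightarrow> ((F \<circ> \<gamma>) has_vector_derivative D) (at 0))"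

definition smooth_vector_field :: "'a::euclidean_space set \<Rightarrow> ('a \<Rightarrow> 'a) \<Rightarrow> bool" where
  "smooth_vector_field M X \<longleftrightarrow> smooth_map_on M X \<and> (\<forall>x\<in>M. X x \<in> tangent_space M x)"

text \<open>Only the values of \<open>\<rho> x\<close> on \<open>tangent_space M x\<close>, for \<open>x \<in> M\<close>, are relevant.\<close>

definition riemannian_metric ::
    "'a::euclidean_space set \<Rightarrow> ('a \<Rightarrow> 'a \<Rightarrow> 'a \<Rightarrow> real) \<Rightarrow> bool" where
  "riemannian_metric M \<rho> \<longleftrightarrow>
     (\<forall>x\<in>M. \<forall>\<xi>\<in>tangent_space M x. \<forall>\<eta>\<in>tangent_space M x.
        \<rho> x \<xi> \<eta> = \<rho> x \<eta> \<xi> \<and>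
        (\<xi> \<noteq> 0 \<longrightarrow> \<rho> x \<xi> \<xi> > 0) \<and>
        (\<forall>\<zeta>\<in>tangent_space M x. \<forall>a b. \<rho> x (a *\<^sub>R \<xi> + b *\<^sub>R \<eta>) \<zeta> = a * \<rho> x \<xi> \<zeta> + b * \<rho> x \<eta> \<zeta>)) \<and>
     (\<forall>X Y. smooth_vector_field M X \<and> smooth_vector_field M Y \<longrightarrow>
        smooth_map_on M (\<lambda>x. \<rho> x (X x) (Y x)))"

definition metric_operator :: "'a::euclidean_space set \<Rightarrow> ('a \<Rightarrow> 'a \<Rightarrow>\<^sub>L 'a) \<Rightarrow> bool" where
  "metric_operator M g \<longleftrightarrow>
     smooth_map_on M g \<and>
     (\<forall>x\<in>M. (\<forall>u w. inner (g x u) w = inner u (g x w)) \<and>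
             (\<forall>u. u \<noteq> 0 \<longrightarrow> inner u (g x u) > 0))"

definition embedded_ambient_structure ::
    "nat \<Rightarrow> 'a::euclidean_space set \<Rightarrow> ('a \<Rightarrow> 'a \<Rightarrow> 'a \<Rightarrow> real) \<Rightarrow> ('a \<Rightarrow> 'a \<Rightarrow>\<^sub>L 'a) \<Rightarrow> bool" where
  "embedded_ambient_structure d M \<rho> g \<longleftrightarrow>
     embedded_submanifold d M \<and> riemannian_metric M \<rho> \<and> metric_operator M g \<and>
     (\<forall>x\<in>M. \<forall>\<xi>\<in>tangent_space M x. \<forall>\<eta>\<in>tangent_space M x. inner \<xi> (g x \<eta>) = \<rho> x \<xi> \<eta>)"

text \<open>The projection onto \<open>tangent_space M x\<close> orthogonal for the inner product \<open>\<langle>\<cdot>, g\<^sub>x \<cdot>\<rangle>\<close>.\<close>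

definition metric_projection ::
    "'a::euclidean_space set \<Rightarrow> ('a \<Rightarrow> 'a \<Rightarrow>\<^sub>L 'a) \<Rightarrow> 'a \<Rightarrow> 'a \<Rightarrow>\<^sub>L 'a" where
  "metric_projection M g x =
     (THE P. \<forall>u. blinfun_apply P u \<in> tangent_space M x \<and>
                 (\<forall>\<eta>\<in>tangent_space M x. inner (u - blinfun_apply P u) (g x \<eta>) = 0))"

end

theory Submission
  imports Defs
begin

text \<open>
  Everything is read off from slice charts. Let \<open>\<phi> : U \<rightarrow> V\<close> be a diffeomorphism of open sets that maps
  \<open>U \<inter> M\<close> onto \<open>V \<inter> L\<close> for a linear subspace \<open>L\<close>. Then the tangent space of \<open>M\<close> at \<open>x\<close> is the
  preimage of \<open>L\<close> under \<open>D\<phi>(x)\<close> (\<open>tangent_space_slice_chart\<close>), and therefore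
  \<open>(x, v) \<mapsto> (\<phi> x, D\<phi>(x) v)\<close> is a slice chart of the tangent bundle with model \<open>L \<times> L\<close>
  (\<open>slice_chart_tangent_bundle\<close>). So the tangent bundle is again embedded, with twice the dimension;
  doing this twice gives the fourfold dimension. Applying the description of tangent spaces to the new
  chart shows that \<open>(a, b)\<close> is tangent to the tangent bundle at \<open>(x, v)\<close> iff \<open>D\<phi>(x) a\<close> and
  \<open>D\<^sup>2\<phi>(x)(a, v) + D\<phi>(x) b\<close> lie in \<open>L\<close> (\<open>second_tangent_bundle_slice_chart\<close>). Together with the
  condition \<open>D\<phi>(x) v \<in> L\<close> this is symmetric in \<open>v\<close> and \<open>a\<close> because second derivatives are symmetric, which
  gives the exchange of \<open>v\<close> and \<open>a\<close> (\<open>second_tangent_bundle_flip\<close>).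

  A vector is tangent iff the metric projection \<open>P\<close> fixes it, so along a curve \<open>(x(t), v(t))\<close> in the
  tangent bundle \<open>P(x(t)) v(t) = v(t)\<close>; differentiating at \<open>t = 0\<close> gives the equation
  \<open>(D\<^sub>a P) v + P b = b\<close>. This needs \<open>P\<close> to be differentiable along curves in \<open>M\<close>, with a derivative that
  depends on the velocity only (\<open>metric_projection_has_dir_deriv\<close>): \<open>P\<close> solves a linear system
  \<open>R\<^sub>y \<circ> P\<^sub>y = S\<^sub>y\<close> whose coefficients extend differentiably to a neighbourhood in the ambient space.
  Conversely, the chart provides some \<open>c\<close> with \<open>(a, c)\<close> tangent at \<open>(x, v)\<close>. If \<open>b\<close> satisfies the equation
  as well, then \<open>P (b - c) = b - c\<close>, so \<open>b - c\<close> is tangent to \<open>M\<close>; and adding a tangent vector to the last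
  component preserves the chart condition (\<open>second_tangent_bundle_eq\<close>).
\<close>

section \<open>Calculus of continuously differentiable maps\<close>

abbreviation D :: "('a::euclidean_space \<Rightarrow> 'b::real_normed_vector) \<Rightarrow> 'a \<Rightarrow> 'a \<Rightarrow> 'b" where
  "D f x \<equiv> frechet_derivative f (at x)"

lemma has_derivative_D: "f differentiable (at x) \<Longrightarrow> (f has_derivative D f x) (at x)"
  by (simp add: frechet_derivative_works)

lemma D_eqI: "(f has_derivative f') (at x) \<Longrightarrow> D f x = f'"
  by (rule frechet_derivative_at[symmetric])

lemma linear_D: "f differentiable (at x) \<Longrightarrow> linear (D f x)"
  by (rule linear_frechet_derivative)

lemma Ck_on_cong:
  assumes "open U" "\<And>x. x \<in> U \<Longrightarrow> f x = g x" "Ck_on k f U"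
  shows "Ck_on k g U"
  using assms(2,3)
proof (induction k arbitrary: f g)
  case 0
  then show ?case by (simp cong: continuous_on_cong)
next
  case (Suc k)
  have df: "\<And>x. x \<in> U \<Longrightarrow> f differentiable (at x)" using Suc.prems by simp
  have eq: "D f x = D g x" if "x \<in> U" for x
    by (rule frechet_derivative_transform_within_open[OF df[OF that] assms(1) that])
       (use Suc.prems in auto)
  have dg: "g differentiable (at x)" if "x \<in> U" for x
    using has_derivative_transform_within_open[OF has_derivative_D[OF df[OF that]] assms(1) that]
      Suc.prems(1) by (auto simp: differentiable_def)
  have "Ck_on k (\<lambda>x. D g x v) U" for v
    by (rule Suc.IH[of "\<lambda>x. D f x v"]) (use Suc.prems eq in auto)
  with dg show ?case by simp
qed

lemma Ck_on_SucI:
  assumes "open U" "\<And>x. x \<in> U \<Longrightarrow> (f has_derivative f' x) (at x)"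
    "\<And>v. Ck_on k (\<lambda>x. f' x v) U"
  shows "Ck_on (Suc k) f U"
proof -
  have "Ck_on k (\<lambda>x. D f x v) U" for v
    by (rule Ck_on_cong[OF assms(1) _ assms(3)[of v]]) (simp add: D_eqI[OF assms(2)])
  with assms(2) show ?thesis by (auto simp: differentiable_def)
qed

lemma Ck_on_SucD: "Ck_on (Suc k) f U \<Longrightarrow> Ck_on k f U"
proof (induction k arbitrary: f)
  case 0
  then show ?case
    by (auto simp: intro!: continuous_at_imp_continuous_on differentiable_imp_continuous_within)
next
  case (Suc k)
  have "Ck_on k (\<lambda>x. D f x v) U" for v
    by (rule Suc.IH) (use Suc.prems in simp)
  with Suc.prems show ?case by simp
qed

lemma Ck_on_SucE:
  assumes "Ck_on (Suc k) f U"
  shows "x \<in> U \<Longrightarrow> (f has_derivative D f x) (at x)" "Ck_on k (\<lambda>x. D f x v) U"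
  using assms by (auto intro: has_derivative_D)

lemma Ck_on_const: "open U \<Longrightarrow> Ck_on k (\<lambda>x. c) U"
proof (induction k arbitrary: c)
  case (Suc k)
  show ?case by (rule Ck_on_SucI[OF Suc.prems, where f' = "\<lambda>x v. 0"]) (simp_all add: Suc)
qed auto

text \<open>
  Charts of the tangent bundle are built from a smooth map and its partial derivatives by sums, affine
  substitutions and products with linear functions, so the chain and product rules are needed for these only. The
  derivative of each such expression has the same form again, at the next lower order.
\<close>

lemma Ck_on_add:
  assumes "open U" "Ck_on k f U" "Ck_on k g U"
  shows "Ck_on k (\<lambda>x. f x + g x) U"
  using assms(2,3)
proof (induction k arbitrary: f g)
  case 0
  then show ?case by (simp add: continuous_on_add)
next
  case (Suc k)
  show ?case
    by (rule Ck_on_SucI[OF assms(1), where f' = "\<lambda>x v. D f x v + D g x v"])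
       (use Suc in \<open>auto intro!: has_derivative_add has_derivative_D\<close>)
qed

lemma Ck_on_sum:
  assumes "open U" "finite I" "\<And>i. i \<in> I \<Longrightarrow> Ck_on k (f i) U"
  shows "Ck_on k (\<lambda>x. \<Sum>i\<in>I. f i x) U"
  using assms(2,3)
proof (induction I rule: finite_induct)
  case empty
  then show ?case by (simp add: Ck_on_const assms(1))
next
  case (insert i I)
  then show ?case by (simp add: Ck_on_add[OF assms(1)])
qed

lemma Ck_on_bounded_linear:
  assumes "open U" "bounded_linear A" "Ck_on k f U"
  shows "Ck_on k (\<lambda>x. A (f x)) U"
  using assms(3)
proof (induction k arbitrary: f)
  case 0
  then show ?case by (auto intro: bounded_linear.continuous_on[OF assms(2)])
next
  case (Suc k)
  show ?case
    by (rule Ck_on_SucI[OF assms(1), where f' = "\<lambda>x v. A (D f x v)"])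
       (use Suc in \<open>auto intro!: bounded_linear.has_derivative[OF assms(2)] has_derivative_D\<close>)
qed

lemma Ck_on_Pair:
  assumes "open U" "Ck_on k f U" "Ck_on k g U"
  shows "Ck_on k (\<lambda>x. (f x, g x)) U"
proof -
  have "bounded_linear (\<lambda>y. (y, 0))" "bounded_linear (\<lambda>y. (0, y))"
    by (simp_all add: bounded_linear_Pair bounded_linear_ident bounded_linear_zero)
  then have "Ck_on k (\<lambda>x. (f x, 0) + (0, g x)) U"
    using Ck_on_add[OF assms(1) Ck_on_bounded_linear[OF assms(1) _ assms(2)]
        Ck_on_bounded_linear[OF assms(1) _ assms(3)]] by blast
  then show ?thesis by simp
qed

lemma Ck_on_affine_substitution:
  assumes "open U" "bounded_linear A" "Ck_on k f U"
  shows "Ck_on k (\<lambda>z. f (a + A z)) ((\<lambda>z. a + A z) -` U)"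
proof -
  have cont: "continuous_on UNIV (\<lambda>z. a + A z)"
    by (intro continuous_intros linear_continuous_on assms)
  have op: "open ((\<lambda>z. a + A z) -` U)"
    by (rule open_vimage[OF assms(1) cont])
  show ?thesis using assms(3)
  proof (induction k arbitrary: f)
    case 0
    then show ?case
      by (auto intro!: continuous_on_compose2[of U f] continuous_on_subset[OF cont])
  next
    case (Suc k)
    show ?case
    proof (rule Ck_on_SucI[OF op, where f' = "\<lambda>z v. D f (a + A z) (A v)"])
      fix z assume "z \<in> (\<lambda>z. a + A z) -` U"
      then have "(f has_derivative D f (a + A z)) (at (a + A z))" using Suc.prems
        by (auto intro: has_derivative_D)
      moreover have "((\<lambda>z. a + A z) has_derivative A) (at z)"
        by (auto intro!: derivative_eq_intros bounded_linear_imp_has_derivative assms)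
      ultimately show "((\<lambda>z. f (a + A z)) has_derivative (\<lambda>v. D f (a + A z) (A v))) (at z)"
        using has_derivative_compose by blast
    next
      fix v
      show "Ck_on k (\<lambda>z. D f (a + A z) (A v)) ((\<lambda>z. a + A z) -` U)"
        by (rule Suc.IH[of "\<lambda>x. D f x (A v)"]) (use Suc.prems in auto)
    qed
  qed
qed

text \<open>
  The derivative of \<open>l \<cdot> f\<close> in direction \<open>v\<close> is \<open>l \<cdot> D f v + l v \<cdot> f\<close>: the first summand has the same
  shape at a lower order, and the second is a constant multiple of \<open>f\<close>.
\<close>

lemma Ck_on_scaleR_linear:
  assumes "open U" "bounded_linear l" "Ck_on k f U"
  shows "Ck_on k (\<lambda>z. l z *\<^sub>R f z) U"
  using assms(3)
proof (induction k arbitrary: f)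
  case 0
  have "continuous_on U l" by (rule linear_continuous_on[OF assms(2)])
  with 0 show ?case by (auto intro: continuous_on_scaleR)
next
  case (Suc k)
  show ?case
  proof (rule Ck_on_SucI[OF assms(1), where f' = "\<lambda>z v. l z *\<^sub>R D f z v + l v *\<^sub>R f z"])
    fix z assume "z \<in> U"
    then have "(f has_derivative D f z) (at z)" using Suc.prems by (auto intro: has_derivative_D)
    then show "((\<lambda>z. l z *\<^sub>R f z) has_derivative (\<lambda>v. l z *\<^sub>R D f z v + l v *\<^sub>R f z)) (at z)"
      by (intro has_derivative_scaleR bounded_linear_imp_has_derivative assms)
  next
    fix v
    have "Ck_on k (\<lambda>z. l v *\<^sub>R f z) U"
      by (rule Ck_on_bounded_linear[OF assms(1) bounded_linear_scaleR_right Ck_on_SucD[OF Suc.prems]])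
    then show "Ck_on k (\<lambda>z. l z *\<^sub>R D f z v + l v *\<^sub>R f z) U"
      by (intro Ck_on_add assms(1) Suc.IH) (use Suc.prems in auto)
  qed
qed

lemma smooth_on_has_derivative: "smooth_on f U \<Longrightarrow> x \<in> U \<Longrightarrow> (f has_derivative D f x) (at x)"
  unfolding smooth_on_def using Ck_on_SucE(1) by blast

lemma smooth_on_D: "smooth_on f U \<Longrightarrow> smooth_on (\<lambda>x. D f x v) U"
  unfolding smooth_on_def using Ck_on_SucE(2) by blast

lemma smooth_on_differentiable: "smooth_on f U \<Longrightarrow> x \<in> U \<Longrightarrow> f differentiable (at x)"
  using smooth_on_has_derivative differentiable_def by blast

section \<open>Symmetry of second derivatives\<close>

text \<open>
  Two applications of the mean value theorem: first in direction \<open>u\<close> to \<open>s \<mapsto> f(x + su + hv) - f(x + su)\<close>,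
  then in direction \<open>v\<close> to the derivative. Only the conclusion distinguishes \<open>u\<close> from \<open>v\<close>: the second
  difference itself is symmetric in the two directions.
\<close>

lemma second_difference_eq_second_derivative:
  fixes f :: "'a::euclidean_space \<Rightarrow> real"
  assumes "0 < h" and seg: "\<And>s t. 0 \<le> s \<Longrightarrow> s \<le> h \<Longrightarrow> 0 \<le> t \<Longrightarrow> t \<le> h \<Longrightarrow> x + s *\<^sub>R u + t *\<^sub>R v \<in> U"
    and d1: "\<And>y. y \<in> U \<Longrightarrow> f differentiable (at y)"
    and d2: "\<And>y. y \<in> U \<Longrightarrow> (\<lambda>y. D f y u) differentiable (at y)"
  obtains s t where "0 < s" "s < h" "0 < t" "t < h"
    "f (x + h *\<^sub>R u + h *\<^sub>R v) - f (x + h *\<^sub>R u) - (f (x + h *\<^sub>R v) - f x)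
       = h * h * D (\<lambda>y. D f y u) (x + s *\<^sub>R u + t *\<^sub>R v) v"
proof -
  have along: "((\<lambda>r. F (a + r *\<^sub>R w)) has_real_derivative D F (a + r *\<^sub>R w) w) (at r)"
    if "F differentiable (at (a + r *\<^sub>R w))" for F :: "'a \<Rightarrow> real" and a w r
  proof -
    have "((\<lambda>r. a + r *\<^sub>R w) has_derivative (\<lambda>r. r *\<^sub>R w)) (at r)"
      by (auto intro!: derivative_eq_intros)
    from has_derivative_compose[OF this has_derivative_D[OF that]]
    have "((\<lambda>r. F (a + r *\<^sub>R w)) has_derivative (\<lambda>r'. D F (a + r *\<^sub>R w) (r' *\<^sub>R w))) (at r)" .
    then show ?thesis
      by (simp add: has_field_derivative_def linear_cmul[OF linear_D[OF that]] mult_commute_abs)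
  qed
  define G where "G s = f (x + s *\<^sub>R u + h *\<^sub>R v) - f (x + s *\<^sub>R u)" for s
  have "(G has_real_derivative D f (x + s *\<^sub>R u + h *\<^sub>R v) u - D f (x + s *\<^sub>R u) u) (at s)"
    if "0 \<le> s" "s \<le> h" for s
  proof -
    have eq: "x + s *\<^sub>R u + h *\<^sub>R v = (x + h *\<^sub>R v) + s *\<^sub>R u" for s by (simp add: algebra_simps)
    have "x + s *\<^sub>R u + h *\<^sub>R v \<in> U" "x + s *\<^sub>R u \<in> U"
      using seg[of s h] seg[of s 0] that \<open>0 < h\<close> by auto
    then show ?thesis
      unfolding G_def eq by (intro DERIV_diff along d1) (auto simp: algebra_simps)
  qed
  from MVT2[OF \<open>0 < h\<close>, of G, OF this] obtain s where s: "0 < s" "s < h"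
    "G h - G 0 = h * (D f (x + s *\<^sub>R u + h *\<^sub>R v) u - D f (x + s *\<^sub>R u) u)" by auto
  have "((\<lambda>t. D f (x + s *\<^sub>R u + t *\<^sub>R v) u) has_real_derivative
          D (\<lambda>y. D f y u) (x + s *\<^sub>R u + t *\<^sub>R v) v) (at t)"
    if "0 \<le> t" "t \<le> h" for t
    by (rule along[of "\<lambda>y. D f y u" "x + s *\<^sub>R u" t v]) (use seg[of s t] s that in \<open>auto intro!: d2\<close>)
  from MVT2[OF \<open>0 < h\<close>, of "\<lambda>t. D f (x + s *\<^sub>R u + t *\<^sub>R v) u", OF this]
  obtain t where t: "0 < t" "t < h"
    "D f (x + s *\<^sub>R u + h *\<^sub>R v) u - D f (x + s *\<^sub>R u) u
       = h * D (\<lambda>y. D f y u) (x + s *\<^sub>R u + t *\<^sub>R v) v" by auto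
  show ?thesis
    by (rule that[OF s(1,2) t(1,2)]) (use s(3) t(3) in \<open>simp add: G_def\<close>)
qed

text \<open>
  The second difference of step \<open>h\<close> equals \<open>h\<^sup>2\<close> times either mixed derivative at points that
  approach \<open>x\<close> as \<open>h\<close> tends to \<open>0\<close>; continuity of both mixed derivatives then identifies them at \<open>x\<close>.
\<close>

lemma symmetric_second_derivative_real:
  fixes f :: "'a::euclidean_space \<Rightarrow> real"
  assumes "open U" "x \<in> U" "Ck_on 2 f U"
  shows "D (\<lambda>y. D f y u) x v = D (\<lambda>y. D f y v) x u"
proof -
  define p where "p = (\<lambda>u v y. D (\<lambda>y. D f y u) y v)"
  have C: "Ck_on (Suc (Suc 0)) f U" using assms(3) by (simp add: numeral_2_eq_2)
  have d1: "\<And>y. y \<in> U \<Longrightarrow> f differentiable (at y)"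
   and d2: "\<And>y w. y \<in> U \<Longrightarrow> (\<lambda>y. D f y w) differentiable (at y)"
   and cont: "\<And>w z. continuous_on U (p w z)"
    using C by (auto simp: p_def)
  have "dist (p u v x) (p v u x) < e" if "e > 0" for e
  proof -
    obtain r where r: "r > 0" "ball x r \<subseteq> U"
      "\<And>y. y \<in> ball x r \<Longrightarrow> dist (p u v y) (p u v x) < e / 2 \<and> dist (p v u y) (p v u x) < e / 2"
    proof -
      have "\<exists>r>0. \<forall>y. dist y x < r \<longrightarrow> dist (p w z y) (p w z x) < e / 2" for w z
    proof -
      have "continuous (at x) (p w z)"
        using cont[of w z] assms(1,2) by (simp add: continuous_on_eq_continuous_at)
      then show ?thesis
        using \<open>e > 0\<close> unfolding continuous_at_eps_delta by (meson half_gt_zero)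
    qed
      from this[of u v] this[of v u] obtain r1 r2 where "r1 > 0" "r2 > 0"
        "\<And>y. dist y x < r1 \<Longrightarrow> dist (p u v y) (p u v x) < e / 2"
        "\<And>y. dist y x < r2 \<Longrightarrow> dist (p v u y) (p v u x) < e / 2" by blast
      moreover obtain r3 where "r3 > 0" "ball x r3 \<subseteq> U" using assms(1,2) open_contains_ball by blast
      ultimately show ?thesis
        by (intro that[of "min r1 (min r2 r3)"]) (simp_all add: dist_commute subset_iff)
    qed
    \<comment> \<open>This step keeps the whole parallelogram spanned by \<open>h u\<close> and \<open>h v\<close> inside the ball; the \<open>1\<close> covers \<open>u = v = 0\<close>.\<close>
    define h where "h = r / (2 * (norm u + norm v + 1))"
    have n: "norm u + norm v + 1 > 0" using norm_ge_zero[of u] norm_ge_zero[of v] by linarith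
    have h: "h > 0" unfolding h_def using r(1) n by (intro divide_pos_pos) auto
    have near: "x + s *\<^sub>R u + t *\<^sub>R v \<in> ball x r" if "0 \<le> s" "s \<le> h" "0 \<le> t" "t \<le> h" for s t
    proof -
      have "norm (s *\<^sub>R u + t *\<^sub>R v) \<le> s * norm u + t * norm v"
        using that norm_triangle_ineq[of "s *\<^sub>R u" "t *\<^sub>R v"] by simp
      also have "\<dots> \<le> h * norm u + h * norm v"
        using that by (intro add_mono mult_right_mono) auto
      also have "\<dots> < 2 * (h * (norm u + norm v + 1))"
        using h by (simp add: algebra_simps add_pos_nonneg add_nonneg_pos)
      also have "\<dots> = r" using n by (simp add: h_def field_simps)
      finally have "norm (s *\<^sub>R u + t *\<^sub>R v) < r" .
      moreover have "dist x (x + s *\<^sub>R u + t *\<^sub>R v) = norm (s *\<^sub>R u + t *\<^sub>R v)"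
        unfolding add.assoc dist_norm by (metis add_diff_cancel_left' norm_minus_commute)
      ultimately show ?thesis by simp
    qed
    have near': "x + s *\<^sub>R v + t *\<^sub>R u \<in> ball x r" if "0 \<le> s" "s \<le> h" "0 \<le> t" "t \<le> h" for s t
      using near[OF that(3,4,1,2)] by (simp add: add.commute add.left_commute)
    obtain s t where st: "0 < s" "s < h" "0 < t" "t < h"
      "f (x + h *\<^sub>R u + h *\<^sub>R v) - f (x + h *\<^sub>R u) - (f (x + h *\<^sub>R v) - f x)
         = h * h * p u v (x + s *\<^sub>R u + t *\<^sub>R v)"
    proof (rule second_difference_eq_second_derivative[OF h, of x u v U f])
      show "x + s *\<^sub>R u + t *\<^sub>R v \<in> U" if "0 \<le> s" "s \<le> h" "0 \<le> t" "t \<le> h" for s t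
        using near[OF that] r(2) by blast
    qed (simp_all add: d1 d2 p_def)
    obtain s' t' where st': "0 < s'" "s' < h" "0 < t'" "t' < h"
      "f (x + h *\<^sub>R v + h *\<^sub>R u) - f (x + h *\<^sub>R v) - (f (x + h *\<^sub>R u) - f x)
         = h * h * p v u (x + s' *\<^sub>R v + t' *\<^sub>R u)"
    proof (rule second_difference_eq_second_derivative[OF h, of x v u U f])
      show "x + s *\<^sub>R v + t *\<^sub>R u \<in> U" if "0 \<le> s" "s \<le> h" "0 \<le> t" "t \<le> h" for s t
        using near'[OF that] r(2) by blast
    qed (simp_all add: d1 d2 p_def)
    have "x + h *\<^sub>R v + h *\<^sub>R u = x + h *\<^sub>R u + h *\<^sub>R v" by simp
    then have "h * h * p u v (x + s *\<^sub>R u + t *\<^sub>R v) = h * h * p v u (x + s' *\<^sub>R v + t' *\<^sub>R u)"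
      unfolding st(5)[symmetric] st'(5)[symmetric] by (simp add: algebra_simps)
    then have "p u v (x + s *\<^sub>R u + t *\<^sub>R v) = p v u (x + s' *\<^sub>R v + t' *\<^sub>R u)"
      using h by (metis mult_cancel_left mult_eq_0_iff less_irrefl)
    moreover have "dist (p u v (x + s *\<^sub>R u + t *\<^sub>R v)) (p u v x) < e / 2"
      using r(3)[OF near[of s t]] st(1-4) by simp
    moreover have "dist (p v u (x + s' *\<^sub>R v + t' *\<^sub>R u)) (p v u x) < e / 2"
      using r(3)[OF near'[of s' t']] st'(1-4) by simp
    ultimately show ?thesis by (simp add: dist_triangle_half_r)
  qed
  then have "\<not> dist (p u v x) (p v u x) > 0" by blast
  then have "p u v x = p v u x" by simp
  then show ?thesis by (simp add: p_def)
qed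

lemma symmetric_second_derivative:
  fixes f :: "'a::euclidean_space \<Rightarrow> 'b::euclidean_space"
  assumes "open U" "x \<in> U" "Ck_on 2 f U"
  shows "D (\<lambda>y. D f y u) x v = D (\<lambda>y. D f y v) x u"
proof (rule euclidean_eqI)
  fix b :: 'b assume "b \<in> Basis"
  have C: "Ck_on (Suc (Suc 0)) f U" using assms(3) by (simp add: numeral_2_eq_2)
  have comp: "D (\<lambda>y. F y \<bullet> b) y = (\<lambda>w. D F y w \<bullet> b)" if "F differentiable (at y)" for F :: "'a \<Rightarrow> 'b" and y
    by (intro D_eqI has_derivative_inner_left has_derivative_D that)
  have comp2: "D (\<lambda>y. D (\<lambda>z. f z \<bullet> b) y w) x z = D (\<lambda>y. D f y w) x z \<bullet> b" for w z
  proof -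
    have dw: "(\<lambda>y. D f y w) differentiable (at x)" using C assms(2) by auto
    then have d: "(\<lambda>y. D f y w \<bullet> b) differentiable (at x)" by simp
    have "D (\<lambda>y. D (\<lambda>z. f z \<bullet> b) y w) x = D (\<lambda>y. D f y w \<bullet> b) x"
      by (rule frechet_derivative_transform_within_open[OF d assms(1,2), symmetric])
         (use C comp in auto)
    then show ?thesis by (simp add: comp[OF dw])
  qed
  have "Ck_on 2 (\<lambda>y. f y \<bullet> b) U"
    by (rule Ck_on_bounded_linear[OF assms(1) bounded_linear_inner_left assms(3)])
  from symmetric_second_derivative_real[OF assms(1,2) this]
  show "D (\<lambda>y. D f y u) x v \<bullet> b = D (\<lambda>y. D f y v) x u \<bullet> b" by (simp add: comp2)
qed

section \<open>Slice charts and tangent bundles\<close>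

definition slice_chart ::
    "'a::euclidean_space set \<Rightarrow> 'a set \<Rightarrow> 'a set \<Rightarrow> ('a \<Rightarrow> 'a) \<Rightarrow> ('a \<Rightarrow> 'a) \<Rightarrow> 'a set \<Rightarrow> bool" where
  "slice_chart M U V \<phi> \<psi> L \<longleftrightarrow>
     diffeomorphism \<phi> \<psi> U V \<and> subspace L \<and> \<phi> ` (U \<inter> M) = V \<inter> L"

definition tangent_map :: "('a::euclidean_space \<Rightarrow> 'b::euclidean_space) \<Rightarrow> 'a \<times> 'a \<Rightarrow> 'b \<times> 'b" where
  "tangent_map f = (\<lambda>(x, v). (f x, D f x v))"

lemma tangent_map_Pair [simp]: "tangent_map f (x, v) = (f x, D f x v)"
  by (simp add: tangent_map_def)

lemma diffeomorphism_sym: "diffeomorphism \<phi> \<psi> U V \<Longrightarrow> diffeomorphism \<psi> \<phi> V U"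
  by (auto simp: diffeomorphism_def)

lemma diffeomorphism_D:
  assumes "diffeomorphism \<phi> \<psi> U V"
  shows "open U" "open V" "smooth_on \<phi> U" "smooth_on \<psi> V"
    "x \<in> U \<Longrightarrow> \<phi> x \<in> V" "y \<in> V \<Longrightarrow> \<psi> y \<in> U"
    "x \<in> U \<Longrightarrow> \<psi> (\<phi> x) = x" "y \<in> V \<Longrightarrow> \<phi> (\<psi> y) = y"
  using assms by (auto simp: diffeomorphism_def)

lemma diffeomorphism_D_inverse:
  assumes "diffeomorphism \<phi> \<psi> U V" "x \<in> U"
  shows "D \<psi> (\<phi> x) (D \<phi> x v) = v"
proof -
  note d = diffeomorphism_D[OF assms(1)]
  have "((\<lambda>y. \<psi> (\<phi> y)) has_derivative (\<lambda>v. D \<psi> (\<phi> x) (D \<phi> x v))) (at x)"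
    by (rule has_derivative_compose[OF smooth_on_has_derivative[OF d(3)] smooth_on_has_derivative[OF d(4)]])
       (use d assms in auto)
  moreover have "((\<lambda>y. \<psi> (\<phi> y)) has_derivative (\<lambda>v. v)) (at x)"
    by (rule has_derivative_transform_within_open[OF has_derivative_ident d(1) assms(2)]) (simp add: d)
  ultimately show ?thesis by (metis has_derivative_unique)
qed

lemma smooth_on_affine_line:
  assumes "open V" "smooth_on f V" "\<And>t. \<bar>t\<bar> < e \<Longrightarrow> a + t *\<^sub>R w \<in> V"
  shows "smooth_on (\<lambda>t::real. f (a + t *\<^sub>R w)) {-e<..<e}"
  unfolding smooth_on_def
proof
  fix k
  have b: "bounded_linear (\<lambda>t::real. t *\<^sub>R w)" by (rule bounded_linear_scaleR_left)
  have sub: "Ck_on k F W \<Longrightarrow> W' \<subseteq> W \<Longrightarrow> Ck_on k F W'" for F :: "real \<Rightarrow> 'b" and W W'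
    by (induction k arbitrary: F) (auto intro: continuous_on_subset)
  have "Ck_on k (\<lambda>t. f (a + t *\<^sub>R w)) ((\<lambda>t. a + t *\<^sub>R w) -` V)"
    by (rule Ck_on_affine_substitution[OF assms(1) b]) (use assms(2) in \<open>simp add: smooth_on_def\<close>)
  then show "Ck_on k (\<lambda>t. f (a + t *\<^sub>R w)) {-e<..<e}"
    by (rule sub) (use assms(3) in auto)
qed

text \<open>
  A vector orthogonal to \<open>L\<close> has vanishing inner product with \<open>f\<close> near \<open>0\<close>, hence with the derivative, and
  \<open>L\<close> is its own double orthogonal complement.
\<close>

lemma has_vector_derivative_in_subspace:
  fixes f :: "real \<Rightarrow> 'a::euclidean_space"
  assumes "subspace L" "(f has_vector_derivative w) (at 0)" "\<forall>\<^sub>F t in nhds 0. f t \<in> L"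
  shows "w \<in> L"
proof -
  have "inner u w = 0" if u: "u \<in> L\<^sup>\<bottom>" for u
  proof -
    have "((\<lambda>t. inner u (f t)) has_vector_derivative inner u w) (at 0)"
      by (rule bounded_linear.has_vector_derivative[OF bounded_linear_inner_right assms(2)])
    moreover have "\<forall>\<^sub>F t in nhds 0. inner u (f t) = 0"
      using assms(3) by eventually_elim
        (use u in \<open>auto simp: orthogonal_comp_def orthogonal_def inner_commute\<close>)
    then obtain S where S: "open S" "0 \<in> S" "\<And>t. t \<in> S \<Longrightarrow> inner u (f t) = 0"
      unfolding eventually_nhds by blast
    have "((\<lambda>t. inner u (f t)) has_vector_derivative 0) (at 0)"
      by (rule has_vector_derivative_transform_within_open[OF has_vector_derivative_const S(1,2)])
         (simp add: S(3))
    ultimately show ?thesis by (metis vector_derivative_at)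
  qed
  then have "w \<in> L\<^sup>\<bottom>\<^sup>\<bottom>" by (auto simp: orthogonal_comp_def orthogonal_def)
  then show ?thesis using orthogonal_comp_self[OF assms(1)] by blast
qed

lemma curve_eventually_in:
  assumes "curve_with_velocity M x v \<gamma>" "open U" "x \<in> U"
  shows "\<forall>\<^sub>F t in nhds 0. \<gamma> t \<in> U \<inter> M"
proof -
  from assms(1) obtain e where e: "e > 0" "\<gamma> ` {-e<..<e} \<subseteq> M" "\<gamma> 0 = x"
    "(\<gamma> has_vector_derivative v) (at 0)" by (auto simp: curve_with_velocity_def)
  have "\<forall>\<^sub>F t in nhds 0. t \<in> {-e<..<e}" using e(1) by (intro eventually_nhds_in_open) auto
  moreover have "isCont \<gamma> 0" using e(4) has_vector_derivative_continuous by blast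
  then have "filterlim \<gamma> (nhds x) (nhds 0)"
    unfolding continuous_at e(3)[symmetric] by (simp add: tendsto_at_iff_tendsto_nhds)
  then have "\<forall>\<^sub>F t in nhds 0. \<gamma> t \<in> U"
    using assms(2,3) topological_tendstoD by blast
  ultimately show ?thesis by eventually_elim (use e(2) in auto)
qed

lemma has_vector_derivative_along_curve:
  assumes "f differentiable (at x)" "\<gamma> 0 = x" "(\<gamma> has_vector_derivative v) (at 0)"
  shows "((\<lambda>t. f (\<gamma> t)) has_vector_derivative D f x v) (at 0)"
proof -
  have "((\<lambda>t. f (\<gamma> t)) has_derivative (\<lambda>t. D f (\<gamma> 0) (t *\<^sub>R v))) (at 0)"
    by (rule has_derivative_compose[OF assms(3)[unfolded has_vector_derivative_def]])
       (simp add: assms has_derivative_D)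
  then show ?thesis
    by (simp add: has_vector_derivative_def assms(2) linear_cmul[OF linear_D[OF assms(1)]])
qed

text \<open>
  A curve in \<open>M\<close> is carried by \<open>\<phi>\<close> to a curve in \<open>L\<close>, so the image of its velocity lies in \<open>L\<close>. In the
  other direction, a straight line in \<open>L\<close> is pulled back by \<open>\<psi>\<close> to a curve in \<open>M\<close> with the
  prescribed velocity.
\<close>

lemma tangent_space_slice_chart:
  assumes chart: "slice_chart M U V \<phi> \<psi> L" and x: "x \<in> U" "x \<in> M"
  shows "tangent_space M x = {v. D \<phi> x v \<in> L}"
proof (intro set_eqI iffI)
  from chart have diff: "diffeomorphism \<phi> \<psi> U V" and L: "subspace L"
    and img: "\<phi> ` (U \<inter> M) = V \<inter> L" by (auto simp: slice_chart_def)
  note d = diffeomorphism_D[OF diff]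
  fix v
  {
    assume "v \<in> tangent_space M x"
    then obtain \<gamma> where g: "curve_with_velocity M x v \<gamma>" by (auto simp: tangent_space_def)
    have "((\<lambda>t. \<phi> (\<gamma> t)) has_vector_derivative D \<phi> x v) (at 0)"
      by (rule has_vector_derivative_along_curve)
         (use g smooth_on_differentiable[OF d(3) x(1)] in \<open>auto simp: curve_with_velocity_def\<close>)
    moreover have "\<forall>\<^sub>F t in nhds 0. \<phi> (\<gamma> t) \<in> L"
      using curve_eventually_in[OF g d(1) x(1)] by eventually_elim (use img in auto)
    ultimately show "v \<in> {v. D \<phi> x v \<in> L}"
      using has_vector_derivative_in_subspace[OF L] by blast
  next
    assume "v \<in> {v. D \<phi> x v \<in> L}"
    then have w: "D \<phi> x v \<in> L" by simp
    define w where "w = D \<phi> x v"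
    define \<gamma> where "\<gamma> t = \<psi> (\<phi> x + t *\<^sub>R w)" for t :: real
    have y: "\<phi> x \<in> V \<inter> L" using img x by auto
    have "\<forall>\<^sub>F t in nhds 0. \<phi> x + t *\<^sub>R w \<in> V"
    proof -
      have "((\<lambda>t. \<phi> x + t *\<^sub>R w) \<longlongrightarrow> \<phi> x + 0 *\<^sub>R w) (nhds 0)"
        by (intro tendsto_intros) (simp add: filterlim_ident)
      then show ?thesis using topological_tendstoD[OF _ d(2)] y by fastforce
    qed
    then obtain e where e: "e > 0" "\<And>t. \<bar>t\<bar> < e \<Longrightarrow> \<phi> x + t *\<^sub>R w \<in> V"
      unfolding eventually_nhds_metric by (auto simp: dist_real_def)
    have inL: "\<phi> x + t *\<^sub>R w \<in> L" for t
      using y w L by (auto simp: w_def intro!: subspace_add subspace_mul)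
    have inM: "\<gamma> t \<in> M" if "\<bar>t\<bar> < e" for t
    proof -
      have "\<phi> x + t *\<^sub>R w \<in> \<phi> ` (U \<inter> M)" unfolding img using e(2)[OF that] inL by blast
      then show ?thesis using d(7) by (auto simp: \<gamma>_def)
    qed
    have "((\<lambda>t. \<psi> (\<phi> x + t *\<^sub>R w)) has_vector_derivative D \<psi> (\<phi> x) w) (at 0)"
    proof (rule has_vector_derivative_along_curve)
      show "\<psi> differentiable at (\<phi> x)" using smooth_on_differentiable[OF d(4)] y by blast
      show "((\<lambda>t. \<phi> x + t *\<^sub>R w) has_vector_derivative w) (at 0)"
        by (auto intro!: derivative_eq_intros)
    qed simp
    moreover have "D \<psi> (\<phi> x) w = v" unfolding w_def by (rule diffeomorphism_D_inverse[OF diff x(1)])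
    moreover have "smooth_on \<gamma> {-e<..<e}"
      unfolding \<gamma>_def by (rule smooth_on_affine_line[OF d(2,4)]) (use e in auto)
    moreover have "\<gamma> ` {-e<..<e} \<subseteq> M" using inM by auto
    ultimately have "curve_with_velocity M x v \<gamma>"
      using e(1) d(7)[OF x(1)] unfolding curve_with_velocity_def \<gamma>_def by auto
    then show "v \<in> tangent_space M x" by (auto simp: tangent_space_def)
  }
qed

lemma subspace_tangent_space:
  assumes "slice_chart M U V \<phi> \<psi> L" "x \<in> U" "x \<in> M"
  shows "subspace (tangent_space M x)"
proof -
  have "\<phi> differentiable (at x)"
    using assms smooth_on_differentiable by (auto simp: slice_chart_def diffeomorphism_def)
  then have "subspace (D \<phi> x -` L)"
    using assms(1) by (intro linear_subspace_vimage linear_D) (auto simp: slice_chart_def)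
  then show ?thesis by (simp add: tangent_space_slice_chart[OF assms] vimage_def)
qed

text \<open>
  Expanding the vector argument in a basis turns the joint map \<open>(x, v) \<mapsto> D f x v\<close> into a sum of products of a
  linear function of \<open>v\<close> and a partial derivative at \<open>x\<close>, to which the rules above apply.
\<close>

lemma D_eq_sum_Basis:
  "f differentiable (at x) \<Longrightarrow> D f x v = (\<Sum>b\<in>Basis. (v \<bullet> b) *\<^sub>R D f x b)"
  using linear_sum[OF linear_D, of f x "\<lambda>b. (v \<bullet> b) *\<^sub>R b" Basis]
  by (simp add: euclidean_representation linear_cmul[OF linear_D])

lemma smooth_on_tangent_map:
  fixes f :: "'a::euclidean_space \<Rightarrow> 'b::euclidean_space"
  assumes "open U" "smooth_on f U"
  shows "smooth_on (tangent_map f) (U \<times> UNIV)"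
  unfolding smooth_on_def
proof
  fix k
  have op: "open (U \<times> (UNIV :: 'a set))" by (simp add: open_Times assms(1))
  have base: "Ck_on k (\<lambda>z. F (fst z)) (U \<times> (UNIV :: 'a set))" if "smooth_on F U" for F :: "'a \<Rightarrow> 'b"
    using Ck_on_affine_substitution[OF assms(1) bounded_linear_fst, of k F 0] that
    by (auto simp: smooth_on_def vimage_fst)
  have "Ck_on k (\<lambda>z. \<Sum>b\<in>Basis. (snd z \<bullet> b) *\<^sub>R D f (fst z) b) (U \<times> UNIV)"
  proof (rule Ck_on_sum[OF op finite_Basis])
    fix b :: 'a
    have "bounded_linear (\<lambda>z :: 'a \<times> 'a. snd z \<bullet> b)"
      by (rule bounded_linear_compose[OF bounded_linear_inner_left bounded_linear_snd])
    then show "Ck_on k (\<lambda>z. (snd z \<bullet> b) *\<^sub>R D f (fst z) b) (U \<times> UNIV)"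
      by (rule Ck_on_scaleR_linear[OF op]) (rule base[OF smooth_on_D[OF assms(2)]])
  qed
  from Ck_on_Pair[OF op base[OF assms(2)] this]
  show "Ck_on k (tangent_map f) (U \<times> UNIV)"
    by (rule Ck_on_cong[OF op, rotated])
       (auto simp: D_eq_sum_Basis[OF smooth_on_differentiable[OF assms(2)], symmetric])
qed

lemma diffeomorphism_tangent_map:
  assumes "diffeomorphism \<phi> \<psi> U V"
  shows "diffeomorphism (tangent_map \<phi>) (tangent_map \<psi>) (U \<times> UNIV) (V \<times> UNIV)"
proof -
  note d = diffeomorphism_D[OF assms]
  have inv: "D \<psi> (\<phi> x) (D \<phi> x v) = v" if "x \<in> U" for x v
    using diffeomorphism_D_inverse[OF assms that] .
  have inv': "D \<phi> (\<psi> y) (D \<psi> y v) = v" if "y \<in> V" for y v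
    using diffeomorphism_D_inverse[OF diffeomorphism_sym[OF assms] that] .
  have "tangent_map \<phi> ` (U \<times> UNIV) = V \<times> UNIV"
  proof
    show "V \<times> UNIV \<subseteq> tangent_map \<phi> ` (U \<times> UNIV)"
    proof
      fix z assume "z \<in> V \<times> (UNIV :: 'b set)"
      then obtain y w where z: "z = (y, w)" "y \<in> V" by auto
      show "z \<in> tangent_map \<phi> ` (U \<times> UNIV)"
        by (rule image_eqI[of _ _ "(\<psi> y, D \<psi> y w)"]) (use z d inv' in auto)
    qed
  qed (use d in auto)
  moreover have "tangent_map \<psi> ` (V \<times> UNIV) = U \<times> UNIV"
  proof
    show "U \<times> UNIV \<subseteq> tangent_map \<psi> ` (V \<times> UNIV)"
    proof
      fix z assume "z \<in> U \<times> (UNIV :: 'a set)"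
      then obtain y w where z: "z = (y, w)" "y \<in> U" by auto
      show "z \<in> tangent_map \<psi> ` (V \<times> UNIV)"
        by (rule image_eqI[of _ _ "(\<phi> y, D \<phi> y w)"]) (use z d inv in auto)
    qed
  qed (use d in auto)
  ultimately show ?thesis
    unfolding diffeomorphism_def using d inv inv'
    by (auto intro!: open_Times smooth_on_tangent_map)
qed

lemma slice_chart_tangent_bundle:
  assumes "slice_chart M U V \<phi> \<psi> L"
  shows "slice_chart (tangent_bundle M) (U \<times> UNIV) (V \<times> UNIV)
           (tangent_map \<phi>) (tangent_map \<psi>) (L \<times> L)"
proof -
  from assms have diff: "diffeomorphism \<phi> \<psi> U V" and L: "subspace L"
    and img: "\<phi> ` (U \<inter> M) = V \<inter> L" by (auto simp: slice_chart_def)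
  note d = diffeomorphism_D[OF diff]
  have T: "tangent_space M x = {v. D \<phi> x v \<in> L}" if "x \<in> U" "x \<in> M" for x
    by (rule tangent_space_slice_chart[OF assms that])
  have inv': "D \<phi> (\<psi> y) (D \<psi> y v) = v" if "y \<in> V" for y v
    using diffeomorphism_D_inverse[OF diffeomorphism_sym[OF diff] that] .
  have "tangent_map \<phi> ` (U \<times> UNIV \<inter> tangent_bundle M) = V \<times> UNIV \<inter> L \<times> L"
  proof
    show "tangent_map \<phi> ` (U \<times> UNIV \<inter> tangent_bundle M) \<subseteq> V \<times> UNIV \<inter> L \<times> L"
      using img T by (auto simp: tangent_bundle_def)
    show "V \<times> UNIV \<inter> L \<times> L \<subseteq> tangent_map \<phi> ` (U \<times> UNIV \<inter> tangent_bundle M)"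
    proof
      fix z assume "z \<in> V \<times> UNIV \<inter> L \<times> L"
      then obtain y w where z: "z = (y, w)" "y \<in> V" "y \<in> L" "w \<in> L" by auto
      then have "y \<in> \<phi> ` (U \<inter> M)" using img by auto
      then have y: "\<psi> y \<in> U" "\<psi> y \<in> M" using d(7) by auto
      show "z \<in> tangent_map \<phi> ` (U \<times> UNIV \<inter> tangent_bundle M)"
        by (rule image_eqI[of _ _ "(\<psi> y, D \<psi> y w)"])
           (use z y T[OF y] inv' d(8) in \<open>auto simp: tangent_bundle_def\<close>)
    qed
  qed
  then show ?thesis
    using diffeomorphism_tangent_map[OF diff] L by (simp add: slice_chart_def subspace_Times)
qed

lemma embedded_submanifold_iff_slice_charts:
  "embedded_submanifold d M \<longleftrightarrow>
     (\<forall>x\<in>M. \<exists>U V \<phi> \<psi> L. x \<in> U \<and> slice_chart M U V \<phi> \<psi> L \<and> dim L = d)"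
  unfolding embedded_submanifold_def slice_chart_def by meson

lemma embedded_submanifold_tangent_bundle:
  assumes "embedded_submanifold d M"
  shows "embedded_submanifold (2 * d) (tangent_bundle M)"
  unfolding embedded_submanifold_iff_slice_charts
proof
  fix z assume "z \<in> tangent_bundle M"
  then obtain x v where z: "z = (x, v)" "x \<in> M" by (auto simp: tangent_bundle_def)
  with assms obtain U V \<phi> \<psi> L where c: "x \<in> U" "slice_chart M U V \<phi> \<psi> L" "dim L = d"
    unfolding embedded_submanifold_iff_slice_charts by blast
  have "dim (L \<times> L) = 2 * d"
    using c dim_Times[of L L] by (simp add: slice_chart_def)
  then show "\<exists>U V \<phi> \<psi> L. z \<in> U \<and> slice_chart (tangent_bundle M) U V \<phi> \<psi> L \<and> dim L = 2 * d"
    using slice_chart_tangent_bundle[OF c(2)] c(1) z(1)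
    by (intro exI[of _ "U \<times> UNIV"] exI[of _ "V \<times> UNIV"] exI[of _ "tangent_map \<phi>"]
          exI[of _ "tangent_map \<psi>"] exI[of _ "L \<times> L"]) simp
qed

text \<open>
  Used for \<open>A y = D \<phi> y\<close>, where it says that the second derivative is linear in the direction of
  the inner derivative, and for the coefficients of a linear system that depends on the base point.
\<close>

lemma linear_D_parameter:
  fixes A :: "'a::euclidean_space \<Rightarrow> 'c::euclidean_space \<Rightarrow> 'b::euclidean_space"
  assumes "open U" "x \<in> U" "\<And>y. y \<in> U \<Longrightarrow> linear (A y)"
    and diff: "\<And>w. (\<lambda>y. A y w) differentiable (at x)"
  shows "linear (\<lambda>w. D (\<lambda>y. A y w) x \<xi>)"
proof (rule linearI)
  fix w1 w2
  have "((\<lambda>y. A y w1 + A y w2) has_derivative (\<lambda>\<xi>. D (\<lambda>y. A y w1) x \<xi> + D (\<lambda>y. A y w2) x \<xi>)) (at x)"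
    by (intro has_derivative_add has_derivative_D diff)
  then have "((\<lambda>y. A y (w1 + w2)) has_derivative (\<lambda>\<xi>. D (\<lambda>y. A y w1) x \<xi> + D (\<lambda>y. A y w2) x \<xi>)) (at x)"
    by (rule has_derivative_transform_within_open[OF _ assms(1,2)]) (simp add: linear_add[OF assms(3)])
  from D_eqI[OF this]
  show "D (\<lambda>y. A y (w1 + w2)) x \<xi> = D (\<lambda>y. A y w1) x \<xi> + D (\<lambda>y. A y w2) x \<xi>" by simp
next
  fix r w
  have "((\<lambda>y. r *\<^sub>R A y w) has_derivative (\<lambda>\<xi>. r *\<^sub>R D (\<lambda>y. A y w) x \<xi>)) (at x)"
    by (intro has_derivative_scaleR_right has_derivative_D diff)
  then have "((\<lambda>y. A y (r *\<^sub>R w)) has_derivative (\<lambda>\<xi>. r *\<^sub>R D (\<lambda>y. A y w) x \<xi>)) (at x)"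
    by (rule has_derivative_transform_within_open[OF _ assms(1,2)]) (simp add: linear_cmul[OF assms(3)])
  from D_eqI[OF this]
  show "D (\<lambda>y. A y (r *\<^sub>R w)) x \<xi> = r *\<^sub>R D (\<lambda>y. A y w) x \<xi>" by simp
qed

lemma D_tangent_map:
  fixes f :: "'a::euclidean_space \<Rightarrow> 'b::euclidean_space"
  assumes "open U" "smooth_on f U" "x \<in> U"
  shows "D (tangent_map f) (x, v) (a, b) = (D f x a, D (\<lambda>y. D f y v) x a + D f x b)"
proof -
  have df: "f differentiable (at y)" if "y \<in> U" for y
    by (rule smooth_on_differentiable[OF assms(2) that])
  have ddf: "(\<lambda>y. D f y w) differentiable (at x)" for w
    by (rule smooth_on_differentiable[OF smooth_on_D[OF assms(2)] assms(3)])
  have base: "((\<lambda>z. F (fst z)) has_derivative (\<lambda>z. D F x (fst z))) (at (x, v))"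
    if "F differentiable (at x)" for F :: "'a \<Rightarrow> 'b"
    by (rule has_derivative_compose[OF bounded_linear_imp_has_derivative[OF bounded_linear_fst]])
       (simp add: has_derivative_D that)
  have "((\<lambda>z. \<Sum>b\<in>Basis. (snd z \<bullet> b) *\<^sub>R D f (fst z) b) has_derivative
     (\<lambda>h. \<Sum>b\<in>Basis. (v \<bullet> b) *\<^sub>R D (\<lambda>y. D f y b) x (fst h) + (snd h \<bullet> b) *\<^sub>R D f x b)) (at (x, v))"
  proof (rule has_derivative_sum)
    fix b :: 'a
    have "((\<lambda>z :: 'a \<times> 'a. snd z \<bullet> b) has_derivative (\<lambda>h. snd h \<bullet> b)) (at (x, v))"
      by (intro bounded_linear_imp_has_derivative
            bounded_linear_compose[OF bounded_linear_inner_left bounded_linear_snd])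
    from has_derivative_scaleR[OF this base[OF ddf[of b]]]
    show "((\<lambda>z. (snd z \<bullet> b) *\<^sub>R D f (fst z) b) has_derivative
       (\<lambda>h. (v \<bullet> b) *\<^sub>R D (\<lambda>y. D f y b) x (fst h) + (snd h \<bullet> b) *\<^sub>R D f x b)) (at (x, v))" by simp
  qed
  from has_derivative_Pair[OF base[OF df[OF assms(3)]] this]
  have "(tangent_map f has_derivative (\<lambda>h. (D f x (fst h),
     \<Sum>b\<in>Basis. (v \<bullet> b) *\<^sub>R D (\<lambda>y. D f y b) x (fst h) + (snd h \<bullet> b) *\<^sub>R D f x b))) (at (x, v))"
  proof (rule has_derivative_transform_within_open)
    show "open (U \<times> (UNIV :: 'a set))" by (simp add: open_Times assms(1))
  qed (use assms(3) in \<open>auto simp: D_eq_sum_Basis[OF df, symmetric]\<close>)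
  from D_eqI[OF this] have "D (tangent_map f) (x, v) (a, b) = (D f x a,
     (\<Sum>b\<in>Basis. (v \<bullet> b) *\<^sub>R D (\<lambda>y. D f y b) x a) + (\<Sum>c\<in>Basis. (b \<bullet> c) *\<^sub>R D f x c))"
    by (simp add: sum.distrib)
  moreover have lin: "linear (\<lambda>w. D (\<lambda>y. D f y w) x a)"
    by (rule linear_D_parameter[OF assms(1,3)]) (auto intro: linear_D df ddf)
  have "(\<Sum>b\<in>Basis. (v \<bullet> b) *\<^sub>R D (\<lambda>y. D f y b) x a) = D (\<lambda>y. D f y v) x a"
    using linear_sum[OF lin, of "\<lambda>b. (v \<bullet> b) *\<^sub>R b" Basis]
    by (simp add: euclidean_representation linear_cmul[OF lin])
  ultimately show ?thesis by (simp add: D_eq_sum_Basis[OF df[OF assms(3)], symmetric])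
qed

lemma second_tangent_bundle_slice_chart:
  assumes chart: "slice_chart M U V \<phi> \<psi> L" and x: "x \<in> U"
  shows "((x, v), (a, b)) \<in> tangent_bundle (tangent_bundle M) \<longleftrightarrow>
     x \<in> M \<and> D \<phi> x v \<in> L \<and> D \<phi> x a \<in> L \<and> D (\<lambda>y. D \<phi> y v) x a + D \<phi> x b \<in> L"
proof -
  have mem: "(x, v) \<in> tangent_bundle M \<longleftrightarrow> x \<in> M \<and> D \<phi> x v \<in> L"
    using tangent_space_slice_chart[OF chart x] by (auto simp: tangent_bundle_def)
  have "tangent_space (tangent_bundle M) (x, v) = {z. D (tangent_map \<phi>) (x, v) z \<in> L \<times> L}"
    if "(x, v) \<in> tangent_bundle M"
    by (rule tangent_space_slice_chart[OF slice_chart_tangent_bundle[OF chart] _ that]) (simp add: x)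
  moreover have "D (tangent_map \<phi>) (x, v) (a, b) = (D \<phi> x a, D (\<lambda>y. D \<phi> y v) x a + D \<phi> x b)"
    using chart by (intro D_tangent_map[OF _ _ x]) (auto simp: slice_chart_def diffeomorphism_def)
  moreover have "((x, v), (a, b)) \<in> tangent_bundle (tangent_bundle M) \<longleftrightarrow>
      (x, v) \<in> tangent_bundle M \<and> (a, b) \<in> tangent_space (tangent_bundle M) (x, v)"
    by (simp add: tangent_bundle_def[of "tangent_bundle M"])
  ultimately show ?thesis using mem by auto
qed

text \<open>
  In the chart description of the second tangent bundle, \<open>v\<close> and \<open>a\<close> occur in the same condition on the first
  derivative and together in the second derivative, which is symmetric.
\<close>

lemma second_tangent_bundle_flip:
  assumes "embedded_submanifold d M" "((x, v), (a, b)) \<in> tangent_bundle (tangent_bundle M)"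
  shows "((x, a), (v, b)) \<in> tangent_bundle (tangent_bundle M)"
proof -
  have "x \<in> M" using assms(2) by (auto simp: tangent_bundle_def)
  then obtain U V \<phi> \<psi> L where c: "x \<in> U" "slice_chart M U V \<phi> \<psi> L"
    using assms(1)[unfolded embedded_submanifold_iff_slice_charts] by meson
  then have "open U" "Ck_on 2 \<phi> U" by (auto simp: slice_chart_def diffeomorphism_def smooth_on_def)
  then have "D (\<lambda>y. D \<phi> y v) x a = D (\<lambda>y. D \<phi> y a) x v"
    by (intro symmetric_second_derivative[OF _ c(1)])
  then show ?thesis
    using assms(2) by (simp add: second_tangent_bundle_slice_chart[OF c(2,1)])
qed

section \<open>The metric projection\<close>

lemma linear_blinfun_apply: "linear (blinfun_apply A)"
  by (rule bounded_linear.linear[OF blinfun.bounded_linear_right])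

text \<open>
  The subspaces \<open>T\<close> and \<open>W = {y. y \<bottom> g ` T}\<close> meet only in \<open>0\<close> by positivity, and their dimensions add up to that
  of the whole space because \<open>g\<close> is injective; so every \<open>u\<close> splits as \<open>p + y\<close> with \<open>p\<close> in \<open>T\<close>
  and \<open>y\<close> in \<open>W\<close>.
\<close>

lemma oblique_projection_exists:
  fixes g :: "'a::euclidean_space \<Rightarrow> 'a"
  assumes T: "subspace T" and g: "linear g" and pos: "\<And>u. u \<noteq> 0 \<Longrightarrow> inner u (g u) > 0"
  shows "\<exists>p\<in>T. \<forall>\<eta>\<in>T. inner (u - p) (g \<eta>) = 0"
proof -
  define W where "W = {y \<in> UNIV. \<forall>x \<in> g ` T. orthogonal x y}"
  have inj: "inj g"
    unfolding linear_injective_0[OF g] using pos by (metis inner_zero_right less_irrefl)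
  have gT: "subspace (g ` T)" by (rule linear_subspace_image[OF g T])
  have W: "subspace W"
    by (auto simp: W_def subspace_def orthogonal_def inner_add_right)
  have "T \<inter> W = {0}"
  proof -
    have "w = 0" if "w \<in> T" "w \<in> W" for w
      using pos[of w] that by (auto simp: W_def orthogonal_def inner_commute)
    then show ?thesis using subspace_0[OF T] subspace_0[OF W] by blast
  qed
  moreover have "dim {x + y |x y. x \<in> T \<and> y \<in> W} + dim (T \<inter> W) = dim T + dim W"
    by (rule dim_sums_Int[OF T W])
  moreover have "dim W + dim (g ` T) = dim (UNIV :: 'a set)"
    unfolding W_def by (rule dim_subspace_orthogonal_to_vectors[OF gT subspace_UNIV]) simp
  moreover have "dim (g ` T) = dim T"
    by (rule dim_image_eq[OF g]) (rule inj_on_subset[OF inj], simp)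
  ultimately have "dim {x + y |x y. x \<in> T \<and> y \<in> W} = DIM('a)" by simp
  moreover have "subspace {x + y |x y. x \<in> T \<and> y \<in> W}" by (rule subspace_sums[OF T W])
  ultimately have "{x + y |x y. x \<in> T \<and> y \<in> W} = UNIV"
    using dim_eq_full[of "{x + y |x y. x \<in> T \<and> y \<in> W}"]
      span_eq_iff[of "{x + y |x y. x \<in> T \<and> y \<in> W}"] by simp
  then have "u \<in> {x + y |x y. x \<in> T \<and> y \<in> W}" by simp
  then obtain p y where py: "u = p + y" "p \<in> T" "y \<in> W" by blast
  then have "\<forall>\<eta>\<in>T. inner (u - p) (g \<eta>) = 0"
    by (auto simp: W_def orthogonal_def inner_commute)
  with py(2) show ?thesis by blast
qed

lemma oblique_projection_unique:
  fixes g :: "'a::euclidean_space \<Rightarrow> 'a"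
  assumes T: "subspace T" and g: "linear g" and pos: "\<And>u. u \<noteq> 0 \<Longrightarrow> inner u (g u) > 0"
    and p: "p \<in> T" "\<And>\<eta>. \<eta> \<in> T \<Longrightarrow> inner (u - p) (g \<eta>) = 0"
    and q: "q \<in> T" "\<And>\<eta>. \<eta> \<in> T \<Longrightarrow> inner (u - q) (g \<eta>) = 0"
  shows "p = q"
proof -
  have "p - q \<in> T" using T p(1) q(1) by (rule subspace_diff)
  then have "inner (p - q) (g (p - q)) = 0"
    using p(2)[of "p - q"] q(2)[of "p - q"] by (simp add: inner_diff_left)
  then show ?thesis using pos[of "p - q"] by fastforce
qed

lemma subspace_tangent_space_embedded_submanifold:
  assumes "embedded_submanifold d M" "x \<in> M"
  shows "subspace (tangent_space M x)"
  using assms(1)[unfolded embedded_submanifold_iff_slice_charts] assms(2) subspace_tangent_space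
  by meson

lemma metric_projection_works:
  assumes emb: "embedded_submanifold d M" and metric: "metric_operator M g" and x: "x \<in> M"
  shows metric_projection_in_tangent_space: "metric_projection M g x u \<in> tangent_space M x"
    and metric_projection_orthogonal:
      "\<eta> \<in> tangent_space M x \<Longrightarrow> inner (u - metric_projection M g x u) (g x \<eta>) = 0"
proof -
  let ?T = "tangent_space M x"
  let ?spec = "\<lambda>P :: 'a \<Rightarrow>\<^sub>L 'a. \<forall>u. P u \<in> ?T \<and> (\<forall>\<eta>\<in>?T. inner (u - P u) (g x \<eta>) = 0)"
  have T: "subspace ?T" by (rule subspace_tangent_space_embedded_submanifold[OF emb x])
  have lin: "linear (blinfun_apply (g x))" by (rule linear_blinfun_apply)
  have pos: "u \<noteq> 0 \<Longrightarrow> inner u (g x u) > 0" for u using metric x by (auto simp: metric_operator_def)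
  note ex = oblique_projection_exists[OF T lin pos] and uniq = oblique_projection_unique[OF T lin pos]
  obtain p where p: "\<And>u. p u \<in> ?T" "\<And>u \<eta>. \<eta> \<in> ?T \<Longrightarrow> inner (u - p u) (g x \<eta>) = 0"
    using ex by metis
  have "linear p"
  proof (rule linearI)
    fix u w
    show "p (u + w) = p u + p w"
    proof (rule uniq)
      fix \<eta> assume "\<eta> \<in> ?T"
      then show "inner (u + w - (p u + p w)) (g x \<eta>) = 0"
        using p(2)[of \<eta> u] p(2)[of \<eta> w] by (simp add: inner_diff_left inner_add_left)
    qed (use p T in \<open>auto intro: subspace_add\<close>)
  next
    fix r u
    show "p (r *\<^sub>R u) = r *\<^sub>R p u"
    proof (rule uniq)
      fix \<eta> assume "\<eta> \<in> ?T"
      then show "inner (r *\<^sub>R u - r *\<^sub>R p u) (g x \<eta>) = 0"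
        using p(2)[of \<eta> u] by (simp add: inner_diff_left)
    qed (use p T in \<open>auto intro: subspace_mul\<close>)
  qed
  then have "?spec (Blinfun p)"
    using p by (simp add: bounded_linear_Blinfun_apply linear_conv_bounded_linear)
  moreover have "P = Q" if "?spec P" "?spec Q" for P Q
    by (rule blinfun_eqI, rule uniq) (use that in auto)
  ultimately have "?spec (metric_projection M g x)"
    unfolding metric_projection_def by (intro theI'[of ?spec] ex1I[of ?spec]) auto
  then show "metric_projection M g x u \<in> ?T"
    "\<eta> \<in> ?T \<Longrightarrow> inner (u - metric_projection M g x u) (g x \<eta>) = 0" by auto
qed

lemma metric_projection_fixed_iff:
  assumes emb: "embedded_submanifold d M" and metric: "metric_operator M g" and x: "x \<in> M"
  shows "metric_projection M g x v = v \<longleftrightarrow> v \<in> tangent_space M x"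
proof
  assume "metric_projection M g x v = v"
  then show "v \<in> tangent_space M x" using metric_projection_in_tangent_space[OF assms, of v] by simp
next
  assume "v \<in> tangent_space M x"
  then show "metric_projection M g x v = v"
  proof (intro oblique_projection_unique[where T = "tangent_space M x" and g = "g x" and u = v])
    show "subspace (tangent_space M x)"
      by (rule subspace_tangent_space_embedded_submanifold[OF emb x])
    show "metric_projection M g x v \<in> tangent_space M x"
      by (rule metric_projection_in_tangent_space[OF assms])
    show "inner (v - metric_projection M g x v) (g x \<eta>) = 0" if "\<eta> \<in> tangent_space M x" for \<eta>
      by (rule metric_projection_orthogonal[OF assms that])
  qed (use metric x in \<open>auto simp: metric_operator_def linear_blinfun_apply\<close>)
qed

section \<open>Differentiability of the metric projection along curves\<close>

text \<open>
  The domain is finite-dimensional, so difference quotients that converge at each vector converge in operator norm.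
\<close>

lemma has_vector_derivative_blinfunI:
  fixes P :: "real \<Rightarrow> 'a::euclidean_space \<Rightarrow>\<^sub>L 'b::real_normed_vector"
  assumes "\<And>u. ((\<lambda>t. P t u) has_vector_derivative blinfun_apply P' u) (at t0)"
  shows "(P has_vector_derivative P') (at t0)"
  unfolding has_vector_derivative_def has_derivative_def
proof (intro conjI bounded_linear_scaleR_left tendsto_componentwise1)
  fix j :: 'a
  show "((\<lambda>t. blinfun_apply ((P t - P (Lim (at t0) (\<lambda>x. x)) - (t - Lim (at t0) (\<lambda>x. x)) *\<^sub>R P') /\<^sub>R norm (t - Lim (at t0) (\<lambda>x. x))) j)
      \<longlongrightarrow> blinfun_apply 0 j) (at t0)"
    using assms[of j] unfolding has_vector_derivative_def has_derivative_def
    by (simp add: blinfun.bilinear_simps)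
qed

text \<open>
  Implicit differentiation of \<open>R\<^sub>t p\<^sub>t = s\<^sub>t\<close>. Differentiability of \<open>p\<close> is part of the claim: the remainder
  \<open>q\<^sub>t = p\<^sub>t - p\<^sub>0 - t p'\<close> satisfies \<open>R\<^sub>t q\<^sub>t = h\<^sub>t\<close>, where \<open>h\<close> is differentiable with
  value and derivative \<open>0\<close> at \<open>0\<close>; and \<open>R\<^sub>t\<close> is bounded below, uniformly for small \<open>t\<close>, since \<open>R\<^sub>0\<close> is
  injective.
\<close>

lemma has_vector_derivative_linear_system:
  fixes R :: "real \<Rightarrow> 'a::euclidean_space \<Rightarrow> 'a"
  assumes lin: "\<forall>\<^sub>F t in nhds 0. linear (R t)"
    and dR: "\<And>w. ((\<lambda>t. R t w) has_vector_derivative R' w) (at 0)"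
    and inj: "\<And>w. R 0 w = 0 \<Longrightarrow> w = 0"
    and ds: "(s has_vector_derivative s') (at 0)"
    and eq: "\<forall>\<^sub>F t in nhds 0. R t (p t) = s t"
    and p': "R' (p 0) + R 0 p' = s'"
  shows "(p has_vector_derivative p') (at 0)"
proof -
  have lin0: "linear (R 0)" and eq0: "R 0 (p 0) = s 0"
    using lin eq by (auto dest: eventually_nhds_x_imp_x)
  have "inj (R 0)" using inj by (simp add: linear_injective_0[OF lin0])
  then obtain c where c: "c > 0" "\<And>w. c * norm w \<le> norm (R 0 w)"
    using linear_inj_bounded_below_pos[OF lin0] by blast
  \<comment> \<open>With this bound on each basis vector, \<open>R t - R 0\<close> has norm at most \<open>c / 2\<close>, half the lower bound of \<open>R 0\<close>.\<close>
  define \<delta> where "\<delta> = c / (2 * real DIM('a))"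
  have \<delta>: "\<delta> > 0" using c(1) by (simp add: \<delta>_def)
  have "\<forall>\<^sub>F t in nhds 0. \<forall>b\<in>Basis. norm (R t b - R 0 b) < \<delta>"
  proof (rule eventually_ball_finite[OF finite_Basis], rule ballI)
    fix b :: 'a
    have "isCont (\<lambda>t. R t b) 0" using dR has_vector_derivative_continuous by blast
    then have "((\<lambda>t. R t b) \<longlongrightarrow> R 0 b) (nhds 0)"
      by (simp add: continuous_at tendsto_at_iff_tendsto_nhds[of "\<lambda>t. R t b" 0])
    from tendstoD[OF this \<delta>] show "\<forall>\<^sub>F t in nhds 0. norm (R t b - R 0 b) < \<delta>"
      by (simp add: dist_norm)
  qed
  with lin have below: "\<forall>\<^sub>F t in nhds 0. \<forall>w. c / 2 * norm w \<le> norm (R t w)"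
  proof eventually_elim
    case (elim t)
    show ?case
    proof
      fix w
      have "linear (\<lambda>w. R t w - R 0 w)" using elim(1) lin0 by (rule linear_compose_sub)
      from linear_sum[OF this, of "\<lambda>b. (w \<bullet> b) *\<^sub>R b" Basis]
      have "R t w - R 0 w = (\<Sum>b\<in>Basis. (w \<bullet> b) *\<^sub>R (R t b - R 0 b))"
        by (simp add: euclidean_representation linear_cmul[OF elim(1)] linear_cmul[OF lin0] scaleR_diff_right)
      also have "norm \<dots> \<le> (\<Sum>b\<in>(Basis :: 'a set). norm w * \<delta>)"
      proof (rule sum_norm_le)
        fix b :: 'a assume b: "b \<in> Basis"
        show "norm ((w \<bullet> b) *\<^sub>R (R t b - R 0 b)) \<le> norm w * \<delta>"
          unfolding norm_scaleR
          using elim(2) b Basis_le_norm[OF b, of w] by (intro mult_mono) (auto intro: less_imp_le)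
      qed
      also have "\<dots> = c / 2 * norm w" by (simp add: \<delta>_def)
      finally have "norm (R t w - R 0 w) \<le> c / 2 * norm w" .
      then show "c / 2 * norm w \<le> norm (R t w)"
        using c(2)[of w] norm_triangle_ineq3[of "R t w" "R 0 w"] by (simp add: abs_le_iff)
    qed
  qed
  define h where "h t = s t - R t (p 0) - t *\<^sub>R R t p'" for t
  have "(h has_vector_derivative (s' - R' (p 0) - (0 *\<^sub>R R' p' + 1 *\<^sub>R R 0 p'))) (at 0)"
    unfolding h_def
    by (intro has_vector_derivative_diff ds dR has_vector_derivative_scaleR DERIV_ident)
  also have "s' - R' (p 0) - (0 *\<^sub>R R' p' + 1 *\<^sub>R R 0 p') = 0" unfolding p'[symmetric] by simp
  finally have "(h has_derivative (\<lambda>t. 0)) (at 0)" by (simp add: has_vector_derivative_def)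
  moreover have h0: "h 0 = 0" by (simp add: h_def eq0)
  ultimately have hsmall: "\<forall>e>0. \<exists>d>0. \<forall>t. norm t < d \<longrightarrow> norm (h t) \<le> e * norm t"
    unfolding has_derivative_at_alt by simp
  have "\<exists>d>0. \<forall>t. norm t < d \<longrightarrow> norm (p t - p 0 - t *\<^sub>R p') \<le> e * norm t" if e: "e > 0" for e
  proof -
    have "c / 2 * e > 0" using c e by simp
    with hsmall obtain d1 where d1: "d1 > 0" "\<And>t. norm t < d1 \<Longrightarrow> norm (h t) \<le> c / 2 * e * norm t"
      by blast
    from eventually_conj[OF eventually_conj[OF lin eq] below] obtain d2 where
      d2: "d2 > 0" "\<And>t. norm t < d2 \<Longrightarrow>
        (linear (R t) \<and> R t (p t) = s t) \<and> (\<forall>w. c / 2 * norm w \<le> norm (R t w))"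
      unfolding eventually_nhds_metric by (auto simp: dist_norm)
    have "norm (p t - p 0 - t *\<^sub>R p') \<le> e * norm t" if t: "norm t < min d1 d2" for t
    proof -
      have l: "linear (R t)" and q: "R t (p t) = s t" using d2(2)[of t] t by auto
      have "R t (p t - p 0 - t *\<^sub>R p') = h t"
        by (simp add: linear_diff[OF l] linear_cmul[OF l] q h_def)
      then have "c / 2 * norm (p t - p 0 - t *\<^sub>R p') \<le> norm (h t)"
        using d2(2)[of t] t by (metis min_less_iff_conj)
      also have "\<dots> \<le> c / 2 * (e * norm t)" using d1(2)[of t] t by (simp add: mult.assoc)
      finally show ?thesis using c(1) by simp
    qed
    with d1(1) d2(1) show ?thesis by (intro exI[of _ "min d1 d2"]) auto
  qed
  then show ?thesis
    unfolding has_vector_derivative_def has_derivative_at_alt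
    by (simp add: bounded_linear_scaleR_left)
qed

text \<open>
  The coefficients are differentiable at \<open>x\<close> as functions on the ambient space, so their derivatives along a curve
  depend only on its velocity. They and \<open>P x\<close> determine the derivative of the solution, which is therefore the same for all curves
  with that velocity.
\<close>

lemma solution_operator_has_dir_deriv:
  fixes R S :: "'a::euclidean_space \<Rightarrow> 'a \<Rightarrow> 'a" and P :: "'a \<Rightarrow> 'a \<Rightarrow>\<^sub>L 'a"
  assumes W: "open W" "x \<in> W" "x \<in> M"
    and R: "\<And>y. y \<in> W \<Longrightarrow> linear (R y)" "\<And>w. (\<lambda>y. R y w) differentiable (at x)"
    and S: "\<And>y. y \<in> W \<Longrightarrow> linear (S y)" "\<And>w. (\<lambda>y. S y w) differentiable (at x)"
    and inj: "\<And>w. R x w = 0 \<Longrightarrow> w = 0"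
    and eq: "\<And>y u. y \<in> W \<Longrightarrow> y \<in> M \<Longrightarrow> R y (P y u) = S y u"
  shows "\<exists>P'. \<forall>\<gamma>. curve_with_velocity M x \<xi> \<gamma> \<longrightarrow> ((P \<circ> \<gamma>) has_vector_derivative P') (at 0)"
proof -
  have "inj (R x)" using inj by (simp add: linear_injective_0[OF R(1)[OF W(2)]])
  then obtain r where r: "linear r" "\<And>w. R x (r w) = w"
    using linear_injective_isomorphism[OF R(1)[OF W(2)]] by blast
  define R' where "R' w = D (\<lambda>y. R y w) x \<xi>" for w
  define S' where "S' u = D (\<lambda>y. S y u) x \<xi>" for u
  define P' where "P' u = r (S' u - R' (P x u))" for u
  have "linear R'" "linear S'"
    unfolding R'_def S'_def by (rule linear_D_parameter[OF W(1,2)]; use R S in blast)+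
  then have "linear P'"
    unfolding P'_def using r(1)
    by (intro linear_compose[OF _ r(1), unfolded o_def] linear_compose_sub
          linear_compose[OF linear_blinfun_apply, unfolded o_def])
  then have P': "blinfun_apply (Blinfun P') = P'"
    by (simp add: bounded_linear_Blinfun_apply linear_conv_bounded_linear)
  have "((P \<circ> \<gamma>) has_vector_derivative Blinfun P') (at 0)"
    if \<gamma>: "curve_with_velocity M x \<xi> \<gamma>" for \<gamma>
  proof (rule has_vector_derivative_blinfunI)
    fix u
    have g0: "\<gamma> 0 = x" "(\<gamma> has_vector_derivative \<xi>) (at 0)"
      using \<gamma> by (auto simp: curve_with_velocity_def)
    note ev = curve_eventually_in[OF \<gamma> W(1,2)]
    show "((\<lambda>t. (P \<circ> \<gamma>) t u) has_vector_derivative Blinfun P' u) (at 0)"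
      unfolding P' o_def
    proof (rule has_vector_derivative_linear_system)
      show "\<forall>\<^sub>F t in nhds 0. linear (R (\<gamma> t))" using ev by eventually_elim (simp add: R)
      show "((\<lambda>t. R (\<gamma> t) w) has_vector_derivative R' w) (at 0)" for w
        unfolding R'_def by (rule has_vector_derivative_along_curve[OF R(2) g0])
      show "((\<lambda>t. S (\<gamma> t) u) has_vector_derivative S' u) (at 0)"
        unfolding S'_def by (rule has_vector_derivative_along_curve[OF S(2) g0])
      show "\<forall>\<^sub>F t in nhds 0. R (\<gamma> t) (P (\<gamma> t) u) = S (\<gamma> t) u"
        using ev by eventually_elim (simp add: eq)
      show "w = 0" if "R (\<gamma> 0) w = 0" for w using inj that g0(1) by simp
      show "R' (P (\<gamma> 0) u) + R (\<gamma> 0) (P' u) = S' u" by (simp add: g0(1) P'_def r(2))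
    qed
  qed
  then show ?thesis by blast
qed

text \<open>
  In a slice chart with an orthonormal basis \<open>B\<close> of \<open>L\<close>, the vectors \<open>X b y = D \<psi> (\<phi> y) b\<close> span the tangent
  space at \<open>y\<close>. Hence \<open>p = P\<^sub>y u\<close> is characterised by two kinds of linear equations: \<open>X b y \<bullet> g\<^sub>y p = X b y \<bullet> g\<^sub>y u\<close>
  for \<open>b\<close> in \<open>B\<close>, which say that \<open>u - p\<close> is orthogonal to the tangent space, and the vanishing of the component
  of \<open>D \<phi> y p\<close> orthogonal to \<open>L\<close>, which says that \<open>p\<close> is tangent. The former can be recorded as a vector in
  \<open>L\<close>, the latter as one in its orthogonal complement; their sum \<open>R y p\<close> is thus a single equation
  \<open>R y p = S y u\<close> in the ambient space, equivalent to both. Off \<open>M\<close>, a smooth extension \<open>G\<close> takes the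
  place of \<open>g\<close>.
\<close>

lemma metric_projection_has_dir_deriv:
  assumes emb: "embedded_submanifold d M" and metric: "metric_operator M g" and x: "x \<in> M"
  shows "\<exists>P'. \<forall>\<gamma>. curve_with_velocity M x \<xi> \<gamma> \<longrightarrow>
           ((metric_projection M g \<circ> \<gamma>) has_vector_derivative P') (at 0)"
proof -
  obtain U V \<phi> \<psi> L where xU: "x \<in> U" and chart: "slice_chart M U V \<phi> \<psi> L"
    using emb[unfolded embedded_submanifold_iff_slice_charts] x by meson
  then have diff: "diffeomorphism \<phi> \<psi> U V" and L: "subspace L" by (auto simp: slice_chart_def)
  note d = diffeomorphism_D[OF diff]
  have pos: "\<And>y u. y \<in> M \<Longrightarrow> u \<noteq> 0 \<Longrightarrow> inner u (blinfun_apply (g y) u) > 0"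
    and sym: "\<And>y u w. y \<in> M \<Longrightarrow> inner (g y u) w = inner u (g y w)"
    using metric by (auto simp: metric_operator_def)
  obtain U' G where G: "open U'" "x \<in> U'" "smooth_on G U'" "\<And>y. y \<in> U' \<Longrightarrow> y \<in> M \<Longrightarrow> G y = g y"
    using metric x unfolding metric_operator_def smooth_map_on_def by blast
  obtain B where B: "pairwise orthogonal B" "\<And>b. b \<in> B \<Longrightarrow> norm b = 1" "independent B" "span B = L"
    using orthonormal_basis_subspace[OF L] by metis
  have finB: "finite B" using B(3) by (rule independent_imp_finite)
  have BL: "b \<in> L" if "b \<in> B" for b using B(4) span_base that by blast
  have coeff: "(\<Sum>c\<in>B. a c *\<^sub>R c) \<bullet> b = a b" if b: "b \<in> B" for a b
  proof -
    have "(\<Sum>c\<in>B. a c *\<^sub>R c) \<bullet> b = (\<Sum>c\<in>B. if c = b then a b else 0)"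
      unfolding inner_sum_left
      by (rule sum.cong) (use B(1) B(2)[OF b] b in
        \<open>auto simp: pairwise_def orthogonal_def dot_square_norm\<close>)
    then show ?thesis using finB b by simp
  qed
  define X where "X b y = D \<psi> (\<phi> y) b" for b y
  define S where "S y u = (\<Sum>b\<in>B. (X b y \<bullet> G y u) *\<^sub>R b)" for y u
  define R where "R y w = S y w + (D \<phi> y w - (\<Sum>b\<in>B. (D \<phi> y w \<bullet> b) *\<^sub>R b))" for y w
  have dphi: "\<phi> differentiable (at y)" if "y \<in> U" for y by (rule smooth_on_differentiable[OF d(3) that])
  have linS: "linear (S y)" for y
    unfolding S_def
    by (intro linearI) (simp_all add: blinfun.bilinear_simps inner_add_right scaleR_add_left sum.distrib scaleR_sum_right)
  have linR: "linear (R y)" if "y \<in> U" for y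
    unfolding R_def
    by (intro linearI) (simp_all add: linear_add[OF linS] linear_cmul[OF linS] linear_add[OF linear_D[OF dphi[OF that]]]
        linear_cmul[OF linear_D[OF dphi[OF that]]] inner_add_left scaleR_add_left sum.distrib scaleR_sum_right algebra_simps)
  have diffX: "X b differentiable (at x)" for b
  proof -
    have "(\<lambda>z. D \<psi> z b) differentiable (at (\<phi> x))"
      by (rule smooth_on_differentiable[OF smooth_on_D[OF d(4)]]) (use d(5) xU in auto)
    from differentiable_chain_at[OF dphi[OF xU] this] show ?thesis
      by (simp add: X_def[abs_def] o_def)
  qed
  have diffG: "(\<lambda>y. G y u) differentiable (at x)" for u
    using bounded_linear.has_derivative[OF blinfun.bounded_linear_left smooth_on_has_derivative[OF G(3,2)]]
    unfolding differentiable_def by blast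
  have diffS: "(\<lambda>y. S y u) differentiable (at x)" for u
    unfolding S_def
    by (intro differentiable_sum finB ballI differentiable_scaleR differentiable_inner diffX diffG) simp_all
  have diffR: "(\<lambda>y. R y w) differentiable (at x)" for w
  proof -
    have "(\<lambda>y. D \<phi> y w) differentiable (at x)"
      by (rule smooth_on_differentiable[OF smooth_on_D[OF d(3)] xU])
    then show ?thesis
      unfolding R_def
      by (intro differentiable_add differentiable_diff diffS differentiable_sum finB ballI
            differentiable_scaleR differentiable_inner) simp_all
  qed
  have T: "tangent_space M y = {v. D \<phi> y v \<in> L}" if "y \<in> U" "y \<in> M" for y
    by (rule tangent_space_slice_chart[OF chart that])
  have XT: "X b y \<in> tangent_space M y" if "y \<in> U" "y \<in> M" "b \<in> B" for b y
    using T[OF that(1,2)] diffeomorphism_D_inverse[OF diffeomorphism_sym[OF diff] d(5)[OF that(1)], of b]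
      BL[OF that(3)] d(7)[OF that(1)] by (simp add: X_def)
  have expand: "(\<Sum>b\<in>B. (z \<bullet> b) *\<^sub>R b) = z" if "z \<in> L" for z
    by (rule orthonormal_basis_expand[OF B(1,2) _ finB]) (use that B(4) in auto)
  \<comment> \<open>\<open>R x w = 0\<close> makes \<open>w\<close> tangent and orthogonal to every tangent vector, in particular to itself.\<close>
  have "w = 0" if w: "R x w = 0" for w
  proof -
    let ?z = "D \<phi> x w"
    have orth: "X b x \<bullet> g x w = 0" if "b \<in> B" for b
    proof -
      have "R x w \<bullet> b = X b x \<bullet> G x w"
        using that by (simp add: R_def S_def inner_add_left inner_diff_left coeff)
      then show ?thesis using w G(2,4) x by simp
    qed
    then have "S x w = 0" using G(2,4) x by (simp add: S_def)
    then have "?z = (\<Sum>b\<in>B. (?z \<bullet> b) *\<^sub>R b)" using w by (simp add: R_def)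
    then have zL: "?z \<in> span B"
      by (metis (no_types, lifting) span_sum span_scale span_base)
    have lin: "linear (\<lambda>\<eta>. D \<psi> (\<phi> x) \<eta> \<bullet> g x w)"
      using linear_D[OF smooth_on_differentiable[OF d(4) d(5)[OF xU]]]
      by (intro linearI) (simp_all add: linear_add linear_cmul inner_add_left)
    have "D \<psi> (\<phi> x) ?z \<bullet> g x w = 0"
      by (rule linear_eq_0_on_span[OF lin _ zL]) (use orth in \<open>simp add: X_def\<close>)
    then have "w \<bullet> g x w = 0" by (simp add: diffeomorphism_D_inverse[OF diff xU])
    then show "w = 0" using pos[OF x, of w] by fastforce
  qed
  moreover have "R y (metric_projection M g y u) = S y u" if y: "y \<in> U \<inter> U'" "y \<in> M" for y u
  proof -
    let ?p = "metric_projection M g y u"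
    have "D \<phi> y ?p \<in> L"
      using metric_projection_in_tangent_space[OF emb metric y(2), of u] T[of y] y by auto
    moreover have "X b y \<bullet> g y ?p = X b y \<bullet> g y u" if "b \<in> B" for b
    proof -
      have "X b y \<in> tangent_space M y" using XT y that by blast
      from metric_projection_orthogonal[OF emb metric y(2) this, of u]
      have "X b y \<bullet> g y (u - ?p) = 0"
        by (simp only: inner_commute[of "X b y"] sym[OF y(2)])
      then show ?thesis by (simp add: blinfun.diff_right inner_diff_right)
    qed
    ultimately show ?thesis using y by (simp add: R_def S_def G(4) expand)
  qed
  ultimately show ?thesis
    by (intro solution_operator_has_dir_deriv[where W = "U \<inter> U'" and R = R and S = S])
       (use d(1) G(1,2) xU x linR linS diffR diffS in auto)
qed

text \<open>
  The directional derivative is a definite description; this unfolds it to the derivative it denotes.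
\<close>

lemma metric_projection_along_curve:
  assumes "embedded_submanifold d M" "metric_operator M g" "x \<in> M"
    and \<gamma>: "curve_with_velocity M x \<xi> \<gamma>"
  shows "((\<lambda>t. metric_projection M g (\<gamma> t)) has_vector_derivative
           dir_deriv M (metric_projection M g) \<xi> x) (at 0)"
proof -
  obtain P' where P': "\<And>\<gamma>. curve_with_velocity M x \<xi> \<gamma> \<Longrightarrow>
      ((metric_projection M g \<circ> \<gamma>) has_vector_derivative P') (at 0)"
    using metric_projection_has_dir_deriv[OF assms(1-3)] by blast
  have "dir_deriv M (metric_projection M g) \<xi> x = P'"
    unfolding dir_deriv_def
  proof (rule the_equality)
    show "P'' = P'" if "\<forall>\<gamma>. curve_with_velocity M x \<xi> \<gamma> \<longrightarrow>
        ((metric_projection M g \<circ> \<gamma>) has_vector_derivative P'') (at 0)" for P''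
      using that P'[OF \<gamma>] \<gamma> vector_derivative_unique_at by blast
  qed (use P' in blast)
  then show ?thesis using P'[OF \<gamma>] by (simp add: o_def)
qed

section \<open>The equation of the second tangent bundle\<close>

lemma curve_fst:
  assumes "curve_with_velocity N z w \<Gamma>" "\<And>p. p \<in> N \<Longrightarrow> fst p \<in> M"
  shows "curve_with_velocity M (fst z) (fst w) (\<lambda>t. fst (\<Gamma> t))"
proof -
  obtain e where e: "e > 0" "smooth_on \<Gamma> {-e<..<e}" "\<Gamma> ` {-e<..<e} \<subseteq> N" "\<Gamma> 0 = z"
    "(\<Gamma> has_vector_derivative w) (at 0)" using assms(1) by (auto simp: curve_with_velocity_def)
  have "smooth_on (\<lambda>t. fst (\<Gamma> t)) {-e<..<e}"
    using e(2) unfolding smooth_on_def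
    by (auto intro: Ck_on_bounded_linear[OF _ bounded_linear_fst])
  moreover have "((\<lambda>t. fst (\<Gamma> t)) has_vector_derivative fst w) (at 0)"
    by (rule bounded_linear.has_vector_derivative[OF bounded_linear_fst e(5)])
  moreover have "(\<lambda>t. fst (\<Gamma> t)) ` {-e<..<e} \<subseteq> M" using e(3) assms(2) by blast
  ultimately show ?thesis unfolding curve_with_velocity_def using e(1,4) by blast
qed

text \<open>
  Differentiate \<open>P(x(t)) v(t) = v(t)\<close> along a curve in the tangent bundle with velocity \<open>(a, b)\<close>.
\<close>

lemma second_tangent_bundle_equation:
  assumes emb: "embedded_submanifold d M" and metric: "metric_operator M g"
    and z: "((x, v), (a, b)) \<in> tangent_bundle (tangent_bundle M)"
  shows "a \<in> tangent_space M x"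
    "dir_deriv M (metric_projection M g) a x v + metric_projection M g x b = b"
proof -
  let ?P = "metric_projection M g"
  have x: "x \<in> M" using z by (auto simp: tangent_bundle_def)
  obtain \<Gamma> where \<Gamma>: "curve_with_velocity (tangent_bundle M) (x, v) (a, b) \<Gamma>"
    using z by (auto simp: tangent_bundle_def[of "tangent_bundle M"] tangent_space_def)
  have \<gamma>: "curve_with_velocity M x a (\<lambda>t. fst (\<Gamma> t))"
    using curve_fst[OF \<Gamma>, of M] by (auto simp: tangent_bundle_def)
  then show "a \<in> tangent_space M x" by (auto simp: tangent_space_def)
  have G0: "\<Gamma> 0 = (x, v)" "(\<Gamma> has_vector_derivative (a, b)) (at 0)"
    using \<Gamma> by (auto simp: curve_with_velocity_def)
  have dv: "((\<lambda>t. snd (\<Gamma> t)) has_vector_derivative b) (at 0)"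
    using bounded_linear.has_vector_derivative[OF bounded_linear_snd G0(2)] by simp
  have "((\<lambda>t. ?P (fst (\<Gamma> t)) (snd (\<Gamma> t))) has_vector_derivative
          ?P (fst (\<Gamma> 0)) b + dir_deriv M ?P a x (snd (\<Gamma> 0))) (at 0)"
    by (rule bounded_bilinear.has_vector_derivative[OF bounded_bilinear_blinfun_apply
          metric_projection_along_curve[OF emb metric x \<gamma>] dv])
  moreover obtain W where W: "open W" "0 \<in> W" "\<And>t. t \<in> W \<Longrightarrow> \<Gamma> t \<in> tangent_bundle M"
    using curve_eventually_in[OF \<Gamma> open_UNIV] unfolding eventually_nhds by blast
  have "((\<lambda>t. ?P (fst (\<Gamma> t)) (snd (\<Gamma> t))) has_vector_derivative b) (at 0)"
  proof (rule has_vector_derivative_transform_within_open[OF dv W(1,2)])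
    fix t assume "t \<in> W"
    then have base: "fst (\<Gamma> t) \<in> M" and "snd (\<Gamma> t) \<in> tangent_space M (fst (\<Gamma> t))"
      using W(3) by (auto simp: tangent_bundle_def split_beta)
    then show "snd (\<Gamma> t) = ?P (fst (\<Gamma> t)) (snd (\<Gamma> t))"
      using metric_projection_fixed_iff[OF emb metric base] by (metis (no_types))
  qed
  ultimately have "?P (fst (\<Gamma> 0)) b + dir_deriv M ?P a x (snd (\<Gamma> 0)) = b"
    by (rule vector_derivative_unique_at)
  then show "dir_deriv M ?P a x v + ?P x b = b" by (simp add: G0(1) add.commute)
qed

text \<open>
  For \<open>x\<close> in \<open>M\<close> and tangent \<open>v\<close> and \<open>a\<close>, both sides describe an affine space of vectors \<open>b\<close> whose direction
  is the tangent space at \<open>x\<close>. One contains the other by the preceding lemma, so a single common point makes them equal; the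
  chart supplies it.
\<close>

lemma second_tangent_bundle_eq:
  assumes emb: "embedded_submanifold d M" and metric: "metric_operator M g"
  shows "((x, v), (a, b)) \<in> tangent_bundle (tangent_bundle M) \<longleftrightarrow>
     x \<in> M \<and> v \<in> tangent_space M x \<and> a \<in> tangent_space M x \<and>
     dir_deriv M (metric_projection M g) a x v + metric_projection M g x b = b"
    (is "?lhs \<longleftrightarrow> ?rhs")
proof
  assume z: ?lhs
  then have "x \<in> M \<and> v \<in> tangent_space M x" by (simp add: tangent_bundle_def)
  with second_tangent_bundle_equation[OF emb metric z] show ?rhs by simp
next
  assume rhs: ?rhs
  let ?P = "metric_projection M g"
  have x: "x \<in> M" using rhs by blast
  obtain U V \<phi> \<psi> L where xU: "x \<in> U" and chart: "slice_chart M U V \<phi> \<psi> L"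
    using emb[unfolded embedded_submanifold_iff_slice_charts] x by meson
  then have diff: "diffeomorphism \<phi> \<psi> U V" and L: "subspace L" by (auto simp: slice_chart_def)
  note d = diffeomorphism_D[OF diff]
  note T = tangent_space_slice_chart[OF chart xU x] and TT = second_tangent_bundle_slice_chart[OF chart xU]
  have lin: "linear (D \<phi> x)" by (rule linear_D[OF smooth_on_differentiable[OF d(3) xU]])
  define q where "q = D (\<lambda>y. D \<phi> y v) x a"
  \<comment> \<open>The choice that makes the second-order component \<open>q + D \<phi> x c\<close> in the chart vanish.\<close>
  define c where "c = - D \<psi> (\<phi> x) q"
  have "D \<phi> x (D \<psi> (\<phi> x) q) = q"
    using diffeomorphism_D_inverse[OF diffeomorphism_sym[OF diff] d(5)[OF xU], of q] d(7)[OF xU] by simp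
  then have "q + D \<phi> x c = 0" by (simp add: c_def linear_neg[OF lin])
  then have "((x, v), (a, c)) \<in> tangent_bundle (tangent_bundle M)"
    using rhs T subspace_0[OF L] by (simp add: TT q_def)
  from second_tangent_bundle_equation(2)[OF emb metric this]
  have "?P x c = c - dir_deriv M ?P a x v" by (metis add_diff_cancel_left')
  moreover have "?P x b = b - dir_deriv M ?P a x v" using rhs by (metis add_diff_cancel_left')
  ultimately have "?P x (b - c) = b - c" by (simp add: blinfun.diff_right)
  then have "D \<phi> x (b - c) \<in> L" using metric_projection_fixed_iff[OF emb metric x] T by auto
  then have "q + D \<phi> x b \<in> L"
    using \<open>q + D \<phi> x c = 0\<close> by (simp add: linear_diff[OF lin] eq_neg_iff_add_eq_0[symmetric] add.commute)
  then show ?lhs using rhs T by (simp add: TT q_def)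
qed

theorem proposition5:
  fixes M :: "'a::euclidean_space set"
    and \<rho> :: "'a \<Rightarrow> 'a \<Rightarrow> 'a \<Rightarrow> real"
    and g :: "'a \<Rightarrow> 'a \<Rightarrow>\<^sub>L 'a"
    and d :: nat
  assumes "embedded_ambient_structure d M \<rho> g"
  shows
    "embedded_submanifold (2 * d) (tangent_bundle M) \<and>
     tangent_bundle M = {(x, v). x \<in> M \<and> metric_projection M g x v = v} \<and>
     embedded_submanifold (4 * d) (tangent_bundle (tangent_bundle M)) \<and>
     tangent_bundle (tangent_bundle M) =
       {((x, v), (\<Delta>\<^sub>m, \<Delta>\<^sub>t)). x \<in> M \<and>
          metric_projection M g x v = v \<and>
          metric_projection M g x \<Delta>\<^sub>m = \<Delta>\<^sub>m \<and>
          dir_deriv M (metric_projection M g) \<Delta>\<^sub>m x v + metric_projection M g x \<Delta>\<^sub>t = \<Delta>\<^sub>t} \<and>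
     (\<forall>x v \<Delta>\<^sub>m \<Delta>\<^sub>t. ((x, v), (\<Delta>\<^sub>m, \<Delta>\<^sub>t)) \<in> tangent_bundle (tangent_bundle M) \<longrightarrow>
        \<Delta>\<^sub>m \<in> tangent_space M x \<and>
        (v = 0 \<or> \<Delta>\<^sub>m = 0 \<longrightarrow> \<Delta>\<^sub>t \<in> tangent_space M x) \<and>
        ((x, \<Delta>\<^sub>m), (v, \<Delta>\<^sub>t)) \<in> tangent_bundle (tangent_bundle M))"
proof -
  have emb: "embedded_submanifold d M" and metric: "metric_operator M g"
    using assms by (auto simp: embedded_ambient_structure_def)
  let ?P = "metric_projection M g" and ?TTM = "tangent_bundle (tangent_bundle M)"
  note fixed = metric_projection_fixed_iff[OF emb metric]
  note TTM = second_tangent_bundle_eq[OF emb metric]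
  have TM: "tangent_bundle M = {(x, v). x \<in> M \<and> ?P x v = v}"
    using fixed by (auto simp: tangent_bundle_def)
  have TTM_eq: "?TTM = {((x, v), (a, b)). x \<in> M \<and> ?P x v = v \<and> ?P x a = a \<and>
      dir_deriv M ?P a x v + ?P x b = b}"
    using TTM fixed by auto
  have emb_TM: "embedded_submanifold (2 * d) (tangent_bundle M)"
    by (rule embedded_submanifold_tangent_bundle[OF emb])
  have emb_TTM: "embedded_submanifold (4 * d) ?TTM"
    using embedded_submanifold_tangent_bundle[OF emb_TM] by simp
  have "a \<in> tangent_space M x \<and> (v = 0 \<or> a = 0 \<longrightarrow> b \<in> tangent_space M x) \<and>
      ((x, a), (v, b)) \<in> ?TTM" if z: "((x, v), (a, b)) \<in> ?TTM" for x v a b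
  proof -
    have flip: "((x, a), (v, b)) \<in> ?TTM" by (rule second_tangent_bundle_flip[OF emb z])
    have "b \<in> tangent_space M x" if "((x, 0), (c, b)) \<in> ?TTM" for c
      using that fixed[of x b] unfolding TTM by (simp add: blinfun.zero_right)
    moreover have "a \<in> tangent_space M x" using z unfolding TTM by simp
    ultimately show ?thesis using z flip by blast
  qed
  then have consequences: "\<forall>x v a b. ((x, v), (a, b)) \<in> ?TTM \<longrightarrow>
      a \<in> tangent_space M x \<and> (v = 0 \<or> a = 0 \<longrightarrow> b \<in> tangent_space M x) \<and>
      ((x, a), (v, b)) \<in> ?TTM" by (intro allI impI)
  show ?thesis by (intro conjI emb_TM TM emb_TTM TTM_eq consequences)
qed

end
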